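(* Let $\mathbb X$ be a virtual equipment, let $j\colon A\to E$ be a tight-cell, let $T$ be a $j$-relative monad, and suppose that the loose-monad $E(j,T)$ is induced by a tight-cell $\ell\colon A\to C$, i.e. there is an isomorphism of loose-monads $E(j,T)\cong C(\ell,\ell)$. Composition with this isomorphism induces a bijection between $T$-opalgebras and $\ell$-opalgebras (opalgebras for the trivial $\ell$-relative monad), and between their graded morphisms. Thus $T$ admits an opalgebra object if and only if the trivial $\ell$-relative monad admits an opalgebra object, in which case there is an isomorphism $\mathbf{Opalg}(\ell)\cong\mathbf{Opalg}(T)$ commuting with $k_\ell\colon A\to\mathbf{Opalg}(\ell)$ and $k_T\colon A\to\mathbf{Opalg}(T)$. In particular, this holds when $T$ admits a resolution $\ell\dashv_j r$.
   Context: Virtual equipments. A virtual double category has objects; a category of tight-cells $f\colon A\to B$ (the composite of $f\colon A\to B$ and $g\colon B\to C$ is $gf$); loose-cells $p\colon A\nrightarrow B$; and 2-cells, each having as frame a chain of loose-cells $p_1\colon A_1\nrightarrow A_0,\dots,p_n\colon A_n\nrightarrow A_{n-1}$ ($n\ge 0$; chains are always listed in this order, and called a chain from $A_n$ to $A_0$), a loose-cell $q\colon B_n\nrightarrow B_0$, and tight-cells $f_0\colon A_0\to B_0$ (left) and $f_n\colon A_n\to B_n$ (right); 2-cells have identities and associative unital multicategory-style composition. $\phi\colon p_1,\dots,p_n\Rightarrow q$ denotes a 2-cell whose tight-cells are identities; $(\phi_1,\dots,\phi_n)$ denotes juxtaposition. A 2-cell $q_1,\dots,q_m\Rightarrow q$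 is opcartesian if every 2-cell (with any tight-cells) with domain $p_1,\dots,p_l,q_1,\dots,q_m,r_1,\dots,r_n$ factors uniquely through it; then $q$ is the loose-composite $q_1\odot\cdots\odot q_m$ (the loose-identity $A(1,1)\colon A\nrightarrow A$ if $m=0$). A unary 2-cell from $p$ to $q$ with left $f$ and right $g$ is cartesian if every 2-cell into $q$ with left $ff'$ and right $gg'$ factors uniquely through it via a 2-cell with left $f'$ and right $g'$; then $p$ is the restriction $q(f,g)$. A virtual equipment has all loose-identities and restrictions. Write $E(f,g):=E(1,1)(f,g)$; for $f\colon D\to E$, $g\colon A\to E$ it is a loose-cell $A\nrightarrow D$. The canonical isomorphisms $q(f,g)\cong C(f,1)\odot q\odot B(1,g)$ are used implicitly. A 2-cell $f\Rightarrow g$ between tight-cells $A\to B$ is equivalently a 2-cell $B(1,f)\Rightarrow B(1,g)$, or $B(g,1)\Rightarrow B(f,1)$, or $()\Rightarrow B(f,g)$. Restriction is functorial in 2-cells (contravariantly in the first argument, covariantly in the second). For $f\colon A\to B$, $\frown_f\colon ()\Rightarrow B(f,f)$ (corresponding to $1_f$) and $\smile_f\colon B(1,f),B(f,1)\Rightarrow B(1,1)$ are the canonical 2-cells. $\phi(f,g)$ denotes the 2-cell obtained from $\phi$ by restricting along $f$ on the left and $g$ on the right; e.g. $\smile_t(x,y)\colon E(x,t),E(t,y)\Rightarrow E(x,y)$ is composition and $\frown_c(x,y)\colon C(x,y)\Rightarrow C'(cx,cy)$ is the action of $c\colon C\to C'$. For $\phi\colon p_1,\dots,p_n\Rightarrow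 C(x,y)$ and $c\colon C\to C'$, $\phi;c:=\frown_c(x,y)\circ\phi$. Relative monads. A $j$-relative monad $T=(t,\dagger,\eta)$ comprises a tight-cell $t\colon A\to E$, a 2-cell $\dagger\colon E(j,t)\Rightarrow E(t,t)$ and a 2-cell $\eta\colon j\Rightarrow t$ such that: (i) $E(\eta,t)\circ\dagger=1$; (ii) $\dagger\circ E(j,\eta)\circ\frown_j=\frown_t$; (iii) the 2-cells $E(j,t),E(j,t)\Rightarrow E(t,t)$ given by $(\dagger,\dagger)$ followed by $\smile_t(t,t)$, and by $(1,\dagger)$ followed by $\smile_t(j,t)$ followed by $\dagger$, are equal. The trivial $\ell$-relative monad, for $\ell\colon A\to C$, has carrier $\ell$, extension operator $1_{C(\ell,\ell)}$ and unit $1_\ell$. Loose-monads. A loose-monad on $A$ is a loose-cell $s\colon A\nrightarrow A$ with 2-cells $\mu\colon s,s\Rightarrow s$ and $u\colon()\Rightarrow s$ satisfying associativity and unit laws; morphisms are 2-cells $s\Rightarrow s'$ preserving $\mu$ and $u$. $E(j,T)$ is the loose-monad on $E(j,t)$ with unit $E(j,\eta)\circ\frown_j$ and multiplication $(1,\dagger)$ followed by $\smile_t(j,t)\colon E(j,t),E(t,t)\Rightarrow E(j,t)$. For $\ell\colon A\to C$, $C(\ell,\ell)$ is the loose-monad with unit $\frown_\ell$ and multiplication $\smile_\ell(\ell,\ell)$. Resolution. A relative adjunction $\ell\dashv_j r$ consists of tight-cells $\ell\colon A\to C$, $r\colon C\to E$ and an isomorphism $\sharp\colon C(\ell,1)\cong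 E(j,r):\flat$. It induces the $j$-relative monad with carrier $r\ell$, unit $\eta\colon j\Rightarrow r\ell$ corresponding to $\sharp(1,\ell)\circ\frown_\ell$, and extension operator $\frown_r(\ell,\ell)\circ\flat(1,\ell)\colon E(j,r\ell)\Rightarrow E(r\ell,r\ell)$. It is a resolution of $T$ if this induced $j$-relative monad equals $T$. Opalgebras. A $T$-opalgebra is a tight-cell $a\colon A\to B$ with a 2-cell $\ltimes\colon E(j,t)\Rightarrow B(a,a)$ such that $\ltimes\circ E(j,\eta)\circ\frown_j=\frown_a$ and the 2-cells $E(j,t),E(j,t)\Rightarrow B(a,a)$ given by $(\ltimes,\ltimes)$ followed by $\smile_a(a,a)$, and by $(1,\dagger)$ followed by $\smile_t(j,t)$ followed by $\ltimes$, are equal. For a chain $p_1,\dots,p_n$ from $B$ to $B'$, a $(p_1,\dots,p_n)$-graded $T$-opalgebra morphism from $(a\colon A\to B,\ltimes)$ to $(a'\colon A\to B',\ltimes')$ is a 2-cell $\alpha\colon p_1,\dots,p_n,B(1,a)\Rightarrow B'(1,a')$ such that the 2-cells $p_1,\dots,p_n,B(1,a),E(j,t)\Rightarrow B'(1,a')$ given by $(1,\dots,1,\rho)$ followed by $\alpha$, and by $(\alpha,1)$ followed by $\rho'$, are equal; here $\rho\colon B(1,a),E(j,t)\Rightarrow B(1,a)$ is $(1,\ltimes)$ followed by $\smile_a(1,a)$, and similarly $\rho'$. Opalgebra object. A $T$-opalgebra $(k_T\colon A\to\mathbf{Opalg}(T),\ltimes_T)$ is an opalgebra object for $T$ when: (1)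 for every $T$-opalgebra $(a\colon A\to B,\ltimes)$ there is a unique tight-cell $[]_{(a,\ltimes)}\colon\mathbf{Opalg}(T)\to B$ with $[]_{(a,\ltimes)}k_T=a$ and $\ltimes_T;[]_{(a,\ltimes)}=\ltimes$; (2) for every graded $T$-opalgebra morphism $\alpha\colon p_1,\dots,p_n,B(1,a)\Rightarrow B'(1,a')$ there is a unique 2-cell $[]_\alpha\colon p_1,\dots,p_n,B(1,[]_{(a,\ltimes)})\Rightarrow B'(1,[]_{(a',\ltimes')})$ with $\alpha=[]_\alpha(1,k_T)$. For the trivial $\ell$-relative monad write $k_\ell\colon A\to\mathbf{Opalg}(\ell)$. *)

theory Defs
  imports Main
begin

section \<open>Virtual double categories\<close>

text \<open>
  A chain \<open>p\<^sub>1 : A\<^sub>1 \<rightarrow> A\<^sub>0, \<dots>, p\<^sub>n : A\<^sub>n \<rightarrow> A\<^bsub>n-1\<^esub>\<close> of loose-cells is the list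
  \<open>[p\<^sub>1, \<dots>, p\<^sub>n]\<close>, so that consecutive entries satisfy \<open>ldom p\<^sub>i = lcod p\<^bsub>i+1\<^esub>\<close>.

  The composite of \<open>\<psi> : q\<^sub>1, \<dots>, q\<^sub>m \<Rightarrow> r\<close> with cells \<open>\<phi>\<^sub>1, \<dots>, \<phi>\<^sub>m\<close> is \<open>ccomp \<psi> f [\<phi>\<^sub>1, \<dots>, \<phi>\<^sub>m]\<close>,
  where \<open>f\<close> is the left tight-cell of the juxtaposition \<open>(\<phi>\<^sub>1, \<dots>, \<phi>\<^sub>m)\<close>. It is determined by
  \<open>\<phi>\<^sub>1\<close> if \<open>m > 0\<close>, but for \<open>m = 0\<close> it is a datum of its own: a nullary cell \<open>\<psi>\<close> can be
  precomposed with any tight-cell into the object on which its domain is the empty chain.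
\<close>

record ('o, 't, 'l, 'c) vdc =
  Obj :: "'o set"
  Tight :: "'t set"
  tdom :: "'t \<Rightarrow> 'o"
  tcod :: "'t \<Rightarrow> 'o"
  tid :: "'o \<Rightarrow> 't"
  tcomp :: "'t \<Rightarrow> 't \<Rightarrow> 't"  (infixl "\<cdot>\<index>" 70)
  Loose :: "'l set"
  ldom :: "'l \<Rightarrow> 'o"
  lcod :: "'l \<Rightarrow> 'o"
  Cell :: "'c set"
  csrc :: "'c \<Rightarrow> 'l list"
  ctgt :: "'c \<Rightarrow> 'l"
  cleft :: "'c \<Rightarrow> 't"
  cright :: "'c \<Rightarrow> 't"
  cid :: "'l \<Rightarrow> 'c"
  ccomp :: "'c \<Rightarrow> 't \<Rightarrow> 'c list \<Rightarrow> 'c"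

definition tight :: "('o, 't, 'l, 'c) vdc \<Rightarrow> 't \<Rightarrow> 'o \<Rightarrow> 'o \<Rightarrow> bool" where
  "tight X f A B \<longleftrightarrow> f \<in> Tight X \<and> tdom X f = A \<and> tcod X f = B"

text \<open>\<open>chain X A\<^sub>0 ps A\<^sub>n\<close>: \<open>ps\<close> is a chain from \<open>A\<^sub>n\<close> to \<open>A\<^sub>0\<close>.\<close>

fun chain :: "('o, 't, 'l, 'c) vdc \<Rightarrow> 'o \<Rightarrow> 'l list \<Rightarrow> 'o \<Rightarrow> bool" where
  "chain X A [] B \<longleftrightarrow> A \<in> Obj X \<and> A = B"
| "chain X A (p # ps) B \<longleftrightarrow> p \<in> Loose X \<and> lcod X p = A \<and> chain X (ldom X p) ps B"

definition cell :: "('o, 't, 'l, 'c) vdc \<Rightarrow> 'c \<Rightarrow> 'l list \<Rightarrow> 'l \<Rightarrow> 't \<Rightarrow> 't \<Rightarrow> bool" where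
  "cell X \<phi> ps q f g \<longleftrightarrow>
     \<phi> \<in> Cell X \<and> csrc X \<phi> = ps \<and> ctgt X \<phi> = q \<and> cleft X \<phi> = f \<and> cright X \<phi> = g"

text \<open>\<open>gcell X \<phi> ps q\<close> is \<open>\<phi> : ps \<Rightarrow> q\<close>, a 2-cell whose tight-cells are identities.\<close>

definition gcell :: "('o, 't, 'l, 'c) vdc \<Rightarrow> 'c \<Rightarrow> 'l list \<Rightarrow> 'l \<Rightarrow> bool" where
  "gcell X \<phi> ps q \<longleftrightarrow> cell X \<phi> ps q (tid X (lcod X q)) (tid X (ldom X q))"

text \<open>\<open>juxtaposable X f \<phi>s g\<close>: the right tight-cell of each entry of \<open>\<phi>s\<close> is the left tight-cell
  of the next, and the outer tight-cells are \<open>f\<close> and \<open>g\<close>.\<close>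

fun juxtaposable :: "('o, 't, 'l, 'c) vdc \<Rightarrow> 't \<Rightarrow> 'c list \<Rightarrow> 't \<Rightarrow> bool" where
  "juxtaposable X f [] g \<longleftrightarrow> f \<in> Tight X \<and> f = g"
| "juxtaposable X f (\<phi> # \<phi>s) g \<longleftrightarrow>
     \<phi> \<in> Cell X \<and> cleft X \<phi> = f \<and> juxtaposable X (cright X \<phi>) \<phi>s g"

definition composable :: "('o, 't, 'l, 'c) vdc \<Rightarrow> 'c \<Rightarrow> 't \<Rightarrow> 'c list \<Rightarrow> 't \<Rightarrow> bool" where
  "composable X \<psi> f \<phi>s g \<longleftrightarrow>
     \<psi> \<in> Cell X \<and> juxtaposable X f \<phi>s g \<and> map (ctgt X) \<phi>s = csrc X \<psi> \<and>
     tcod X f = tdom X (cleft X \<psi>)"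

locale virtual_double_category =
  fixes X :: "('o, 't, 'l, 'c) vdc" (structure)
  assumes tight_frame: "f \<in> Tight X \<Longrightarrow> tdom X f \<in> Obj X \<and> tcod X f \<in> Obj X"
    and tid_tight: "A \<in> Obj X \<Longrightarrow> tight X (tid X A) A A"
    and tcomp_tight: "\<lbrakk>tight X f A B; tight X g B C\<rbrakk> \<Longrightarrow> tight X (g \<cdot> f) A C"
    and tcomp_tid_right: "tight X f A B \<Longrightarrow> f \<cdot> tid X A = f"
    and tcomp_tid_left: "tight X f A B \<Longrightarrow> tid X B \<cdot> f = f"
    and tcomp_assoc:
      "\<lbrakk>tight X f A B; tight X g B C; tight X h C D\<rbrakk> \<Longrightarrow> (h \<cdot> g) \<cdot> f = h \<cdot> (g \<cdot> f)"
    and loose_frame: "p \<in> Loose X \<Longrightarrow> ldom X p \<in> Obj X \<and> lcod X p \<in> Obj X"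
    and cell_frame:
      "cell X \<phi> ps q f g \<Longrightarrow>
        \<exists>A\<^sub>0 A\<^sub>n. q \<in> Loose X \<and> chain X A\<^sub>0 ps A\<^sub>n \<and>
                tight X f A\<^sub>0 (lcod X q) \<and> tight X g A\<^sub>n (ldom X q)"
    and cid_gcell: "p \<in> Loose X \<Longrightarrow> gcell X (cid X p) [p] p"
    and ccomp_cell:
      "composable X \<psi> f \<phi>s g \<Longrightarrow>
        cell X (ccomp X \<psi> f \<phi>s) (concat (map (csrc X) \<phi>s)) (ctgt X \<psi>)
          (cleft X \<psi> \<cdot> f) (cright X \<psi> \<cdot> g)"
    and ccomp_cid_right:
      "\<psi> \<in> Cell X \<Longrightarrow> ccomp X \<psi> (tid X (tdom X (cleft X \<psi>))) (map (cid X) (csrc X \<psi>)) = \<psi>"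
    and ccomp_cid_left:
      "\<phi> \<in> Cell X \<Longrightarrow> ccomp X (cid X (ctgt X \<phi>)) (cleft X \<phi>) [\<phi>] = \<phi>"
    and ccomp_assoc:
      "\<lbrakk>composable X \<psi> f \<phi>s g; length \<chi>ss = length \<phi>s; length es = Suc (length \<phi>s);
        es ! 0 \<in> Tight X; tcod X (es ! 0) = tdom X f;
        \<And>i. i < length \<phi>s \<Longrightarrow> composable X (\<phi>s ! i) (es ! i) (\<chi>ss ! i) (es ! Suc i)\<rbrakk> \<Longrightarrow>
        ccomp X (ccomp X \<psi> f \<phi>s) (es ! 0) (concat \<chi>ss) =
        ccomp X \<psi> (f \<cdot> es ! 0)
          (map (\<lambda>i. ccomp X (\<phi>s ! i) (es ! i) (\<chi>ss ! i)) [0..<length \<phi>s])"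

text \<open>Composition of 2-cells whose tight-cells are identities.\<close>

definition gcomp :: "('o, 't, 'l, 'c) vdc \<Rightarrow> 'c \<Rightarrow> 'c list \<Rightarrow> 'c"  (infixl "\<bullet>\<index>" 70) where
  "\<psi> \<bullet>\<^bsub>X\<^esub> \<phi>s = ccomp X \<psi> (cleft X \<psi>) \<phi>s"


section \<open>Virtual equipments\<close>

text \<open>When the domain of \<open>\<phi>\<close> is empty, the place at which \<open>q\<close> is to be inserted is not determined
  by the list \<open>ps @ rs\<close>, hence the explicit endpoints of \<open>ps\<close> and \<open>rs\<close>.\<close>

definition opcartesian :: "('o, 't, 'l, 'c) vdc \<Rightarrow> 'c \<Rightarrow> bool" where
  "opcartesian X \<phi> \<longleftrightarrow>
     (\<exists>qs q. gcell X \<phi> qs q \<and>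
       (\<forall>ps rs s f g \<psi>.
          chain X (tdom X f) ps (lcod X q) \<and> chain X (ldom X q) rs (tdom X g) \<and>
          cell X \<psi> (ps @ qs @ rs) s f g \<longrightarrow>
          (\<exists>!\<psi>'. cell X \<psi>' (ps @ [q] @ rs) s f g \<and>
            ccomp X \<psi>' (tid X (tdom X f)) (map (cid X) ps @ [\<phi>] @ map (cid X) rs) = \<psi>)))"

definition cartesian :: "('o, 't, 'l, 'c) vdc \<Rightarrow> 'c \<Rightarrow> bool" where
  "cartesian X \<kappa> \<longleftrightarrow>
     (\<exists>p q f g. cell X \<kappa> [p] q f g \<and>
       (\<forall>f' g' ps \<psi>.
          tight X f' (tdom X f') (tdom X f) \<and> tight X g' (tdom X g') (tdom X g) \<and>
          cell X \<psi> ps q (f \<cdot>\<^bsub>X\<^esub> f') (g \<cdot>\<^bsub>X\<^esub> g') \<longrightarrow>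
          (\<exists>!\<chi>. cell X \<chi> ps p f' g' \<and> ccomp X \<kappa> f' [\<chi>] = \<psi>)))"

text \<open>\<open>is_lunit X A \<upsilon>\<close>: \<open>\<upsilon> : () \<Rightarrow> p\<close> exhibits a loose-cell \<open>p : A \<rightarrow> A\<close> as the loose-identity of \<open>A\<close>.\<close>

definition is_lunit :: "('o, 't, 'l, 'c) vdc \<Rightarrow> 'o \<Rightarrow> 'c \<Rightarrow> bool" where
  "is_lunit X A \<upsilon> \<longleftrightarrow>
     opcartesian X \<upsilon> \<and> (\<exists>p. ldom X p = A \<and> lcod X p = A \<and> gcell X \<upsilon> [] p)"

text \<open>\<open>is_rcell X q f g \<kappa>\<close>: \<open>\<kappa>\<close> exhibits a loose-cell as the restriction \<open>q(f,g)\<close>.\<close>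

definition is_rcell :: "('o, 't, 'l, 'c) vdc \<Rightarrow> 'l \<Rightarrow> 't \<Rightarrow> 't \<Rightarrow> 'c \<Rightarrow> bool" where
  "is_rcell X q f g \<kappa> \<longleftrightarrow> cartesian X \<kappa> \<and> (\<exists>p. cell X \<kappa> [p] q f g)"

locale virtual_equipment = virtual_double_category X
  for X :: "('o, 't, 'l, 'c) vdc" (structure) +
  assumes loose_identities: "A \<in> Obj X \<Longrightarrow> \<exists>\<upsilon>. is_lunit X A \<upsilon>"
    and restrictions:
      "\<lbrakk>q \<in> Loose X; f \<in> Tight X; g \<in> Tight X; tcod X f = lcod X q; tcod X g = ldom X q\<rbrakk> \<Longrightarrow>
        \<exists>\<kappa>. is_rcell X q f g \<kappa>"

text \<open>
  Loose-identities and restrictions are unique up to canonical isomorphism; a choice is fixed here.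
  In the notation of the literature, \<open>lid X E\<close> is \<open>E(1,1)\<close>, \<open>res X q f g\<close> is \<open>q(f,g)\<close>, and
  \<open>hom X f g\<close> is \<open>E(f,g) = E(1,1)(f,g)\<close> for \<open>f : D \<rightarrow> E\<close> and \<open>g : A \<rightarrow> E\<close>, a loose-cell from \<open>A\<close>
  to \<open>D\<close>. The cell \<open>hcell X f g : E(f,g) \<Rightarrow> E(1,1)\<close>, with left \<open>f\<close> and right \<open>g\<close>, is the cartesian
  one. Each definite description below picks out a factorisation through a cartesian or an
  opcartesian cell, which in a virtual equipment exists uniquely.
\<close>

definition lunit :: "('o, 't, 'l, 'c) vdc \<Rightarrow> 'o \<Rightarrow> 'c" where
  "lunit X A = (SOME \<upsilon>. is_lunit X A \<upsilon>)"

definition lid :: "('o, 't, 'l, 'c) vdc \<Rightarrow> 'o \<Rightarrow> 'l" where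
  "lid X A = ctgt X (lunit X A)"

definition rcell :: "('o, 't, 'l, 'c) vdc \<Rightarrow> 'l \<Rightarrow> 't \<Rightarrow> 't \<Rightarrow> 'c" where
  "rcell X q f g = (SOME \<kappa>. is_rcell X q f g \<kappa>)"

definition res :: "('o, 't, 'l, 'c) vdc \<Rightarrow> 'l \<Rightarrow> 't \<Rightarrow> 't \<Rightarrow> 'l" where
  "res X q f g = hd (csrc X (rcell X q f g))"

definition hcell :: "('o, 't, 'l, 'c) vdc \<Rightarrow> 't \<Rightarrow> 't \<Rightarrow> 'c" where
  "hcell X f g = rcell X (lid X (tcod X f)) f g"

definition hom :: "('o, 't, 'l, 'c) vdc \<Rightarrow> 't \<Rightarrow> 't \<Rightarrow> 'l" where
  "hom X f g = res X (lid X (tcod X f)) f g"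

text \<open>The canonical 2-cell \<open>E(fx,gy) \<Rightarrow> E(f,g)\<close> with left \<open>x\<close> and right \<open>y\<close>, exhibiting
  \<open>E(fx,gy)\<close> as the restriction \<open>E(f,g)(x,y)\<close>.\<close>

definition hcart :: "('o, 't, 'l, 'c) vdc \<Rightarrow> 't \<Rightarrow> 't \<Rightarrow> 't \<Rightarrow> 't \<Rightarrow> 'c" where
  "hcart X f g x y =
     (THE \<kappa>. cell X \<kappa> [hom X (f \<cdot>\<^bsub>X\<^esub> x) (g \<cdot>\<^bsub>X\<^esub> y)] (hom X f g) x y \<and>
       ccomp X (hcell X f g) x [\<kappa>] = hcell X (f \<cdot>\<^bsub>X\<^esub> x) (g \<cdot>\<^bsub>X\<^esub> y))"

text \<open>The 2-cell \<open>\<phi>(1,y) : p\<^sub>1, \<dots>, p\<^sub>n, E(f,gy) \<Rightarrow> E'(f',g'y)\<close> for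
  \<open>\<phi> : p\<^sub>1, \<dots>, p\<^sub>n, E(f,g) \<Rightarrow> E'(f',g')\<close>.\<close>

definition restrict_right ::
  "('o, 't, 'l, 'c) vdc \<Rightarrow> 'l list \<Rightarrow> 't \<Rightarrow> 't \<Rightarrow> 't \<Rightarrow> 't \<Rightarrow> 'c \<Rightarrow> 't \<Rightarrow> 'c" where
  "restrict_right X ps f g f' g' \<phi> y =
     (THE \<chi>. gcell X \<chi> (ps @ [hom X f (g \<cdot>\<^bsub>X\<^esub> y)]) (hom X f' (g' \<cdot>\<^bsub>X\<^esub> y)) \<and>
       ccomp X (hcart X f' g' (tid X (tdom X f')) y) (tid X (tdom X f')) [\<chi>] =
       ccomp X \<phi> (tid X (tdom X f')) (map (cid X) ps @ [hcart X f g (tid X (tdom X f)) y]))"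

text \<open>The canonical 2-cell \<open>E(1,1), E(1,1) \<Rightarrow> E(1,1)\<close>.\<close>

definition lmult :: "('o, 't, 'l, 'c) vdc \<Rightarrow> 'o \<Rightarrow> 'c" where
  "lmult X E =
     (THE m. gcell X m [lid X E, lid X E] (lid X E) \<and>
       m \<bullet>\<^bsub>X\<^esub> [lunit X E, cid X (lid X E)] = cid X (lid X E))"

text \<open>\<open>smile X x t y\<close> is the composition 2-cell \<open>\<smile>\<^sub>t(x,y) : E(x,t), E(t,y) \<Rightarrow> E(x,y)\<close>.\<close>

definition smile :: "('o, 't, 'l, 'c) vdc \<Rightarrow> 't \<Rightarrow> 't \<Rightarrow> 't \<Rightarrow> 'c" where
  "smile X x t y =
     (THE \<sigma>. gcell X \<sigma> [hom X x t, hom X t y] (hom X x y) \<and>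
       ccomp X (hcell X x y) (tid X (tdom X x)) [\<sigma>] =
       ccomp X (lmult X (tcod X t)) x [hcell X x t, hcell X t y])"

text \<open>\<open>frown X f\<close> is \<open>\<frown>\<^sub>f : () \<Rightarrow> B(f,f)\<close>, and \<open>frown_ext X f\<close> is the corresponding 2-cell
  \<open>A(1,1) \<Rightarrow> B(f,f)\<close>, whose restriction \<open>A(x,y) \<Rightarrow> B(fx,fy)\<close> is \<open>act X f x y\<close>,
  i.e. \<open>\<frown>\<^sub>f(x,y)\<close>.\<close>

definition frown :: "('o, 't, 'l, 'c) vdc \<Rightarrow> 't \<Rightarrow> 'c" where
  "frown X f =
     (THE \<beta>. gcell X \<beta> [] (hom X f f) \<and>
       ccomp X (hcell X f f) (tid X (tdom X f)) [\<beta>] = ccomp X (lunit X (tcod X f)) f [])"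

definition frown_ext :: "('o, 't, 'l, 'c) vdc \<Rightarrow> 't \<Rightarrow> 'c" where
  "frown_ext X f =
     (THE \<beta>. gcell X \<beta> [lid X (tdom X f)] (hom X f f) \<and>
       \<beta> \<bullet>\<^bsub>X\<^esub> [lunit X (tdom X f)] = frown X f)"

definition act :: "('o, 't, 'l, 'c) vdc \<Rightarrow> 't \<Rightarrow> 't \<Rightarrow> 't \<Rightarrow> 'c" where
  "act X f x y =
     (THE \<beta>. gcell X \<beta> [hom X x y] (hom X (f \<cdot>\<^bsub>X\<^esub> x) (f \<cdot>\<^bsub>X\<^esub> y)) \<and>
       ccomp X (hcart X f f x y) (tid X (tdom X x)) [\<beta>] =
       ccomp X (frown_ext X f) x [hcell X x y])"

text \<open>A 2-cell \<open>\<alpha> : f \<Rightarrow> g\<close> between tight-cells is represented by the corresponding 2-cell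
  \<open>() \<Rightarrow> E(f,g)\<close>. The induced 2-cells \<open>E(x,\<alpha>) : E(x,f) \<Rightarrow> E(x,g)\<close> and
  \<open>E(\<alpha>,y) : E(g,y) \<Rightarrow> E(f,y)\<close> are composition with \<open>\<alpha>\<close>.\<close>

definition hom_post :: "('o, 't, 'l, 'c) vdc \<Rightarrow> 't \<Rightarrow> 't \<Rightarrow> 't \<Rightarrow> 'c \<Rightarrow> 'c" where
  "hom_post X x f g \<alpha> = smile X x f g \<bullet>\<^bsub>X\<^esub> [cid X (hom X x f), \<alpha>]"

definition hom_pre :: "('o, 't, 'l, 'c) vdc \<Rightarrow> 't \<Rightarrow> 't \<Rightarrow> 'c \<Rightarrow> 't \<Rightarrow> 'c" where
  "hom_pre X f g \<alpha> y = smile X f g y \<bullet>\<^bsub>X\<^esub> [\<alpha>, cid X (hom X g y)]"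

definition tight_iso :: "('o, 't, 'l, 'c) vdc \<Rightarrow> 't \<Rightarrow> 'o \<Rightarrow> 'o \<Rightarrow> bool" where
  "tight_iso X h A B \<longleftrightarrow> tight X h A B \<and>
     (\<exists>h'. tight X h' B A \<and> h' \<cdot>\<^bsub>X\<^esub> h = tid X A \<and> h \<cdot>\<^bsub>X\<^esub> h' = tid X B)"


section \<open>Relative monads and loose-monads\<close>

record ('t, 'c) relmonad =
  carrier :: 't
  extension :: 'c
  monad_unit :: 'c

definition relative_monad :: "('o, 't, 'l, 'c) vdc \<Rightarrow> 't \<Rightarrow> ('t, 'c) relmonad \<Rightarrow> bool" where
  "relative_monad X j T \<longleftrightarrow>
     (let t = carrier T; d = extension T; \<eta> = monad_unit T in
       j \<in> Tight X \<and> tight X t (tdom X j) (tcod X j) \<and>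
       gcell X d [hom X j t] (hom X t t) \<and> gcell X \<eta> [] (hom X j t) \<and>
       hom_pre X j t \<eta> t \<bullet>\<^bsub>X\<^esub> [d] = cid X (hom X j t) \<and>
       d \<bullet>\<^bsub>X\<^esub> [hom_post X j j t \<eta> \<bullet>\<^bsub>X\<^esub> [frown X j]] = frown X t \<and>
       smile X t t t \<bullet>\<^bsub>X\<^esub> [d, d] =
         d \<bullet>\<^bsub>X\<^esub> [smile X j t t \<bullet>\<^bsub>X\<^esub> [cid X (hom X j t), d]])"

text \<open>The unit \<open>1\<^sub>\<ell> : \<ell> \<Rightarrow> \<ell>\<close> is represented by \<open>\<frown>\<^sub>\<ell> : () \<Rightarrow> C(\<ell>,\<ell>)\<close>.\<close>

definition trivial_relmonad :: "('o, 't, 'l, 'c) vdc \<Rightarrow> 't \<Rightarrow> ('t, 'c) relmonad" where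
  "trivial_relmonad X l =
     \<lparr> carrier = l, extension = cid X (hom X l l), monad_unit = frown X l \<rparr>"

record ('l, 'c) lmonad =
  lcarrier :: 'l
  lmonad_mult :: 'c
  lmonad_unit :: 'c

definition loose_monad :: "('o, 't, 'l, 'c) vdc \<Rightarrow> 'o \<Rightarrow> ('l, 'c) lmonad \<Rightarrow> bool" where
  "loose_monad X A S \<longleftrightarrow>
     (let s = lcarrier S; \<mu> = lmonad_mult S; u = lmonad_unit S in
       s \<in> Loose X \<and> ldom X s = A \<and> lcod X s = A \<and>
       gcell X \<mu> [s, s] s \<and> gcell X u [] s \<and>
       \<mu> \<bullet>\<^bsub>X\<^esub> [\<mu>, cid X s] = \<mu> \<bullet>\<^bsub>X\<^esub> [cid X s, \<mu>] \<and>
       \<mu> \<bullet>\<^bsub>X\<^esub> [u, cid X s] = cid X s \<and>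
       \<mu> \<bullet>\<^bsub>X\<^esub> [cid X s, u] = cid X s)"

definition loose_monad_morphism ::
  "('o, 't, 'l, 'c) vdc \<Rightarrow> 'o \<Rightarrow> ('l, 'c) lmonad \<Rightarrow> ('l, 'c) lmonad \<Rightarrow> 'c \<Rightarrow> bool" where
  "loose_monad_morphism X A S S' \<phi> \<longleftrightarrow>
     loose_monad X A S \<and> loose_monad X A S' \<and>
     gcell X \<phi> [lcarrier S] (lcarrier S') \<and>
     \<phi> \<bullet>\<^bsub>X\<^esub> [lmonad_mult S] = lmonad_mult S' \<bullet>\<^bsub>X\<^esub> [\<phi>, \<phi>] \<and>
     \<phi> \<bullet>\<^bsub>X\<^esub> [lmonad_unit S] = lmonad_unit S'"

definition loose_monad_iso ::
  "('o, 't, 'l, 'c) vdc \<Rightarrow> 'o \<Rightarrow> ('l, 'c) lmonad \<Rightarrow> ('l, 'c) lmonad \<Rightarrow> 'c \<Rightarrow> bool" where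
  "loose_monad_iso X A S S' \<phi> \<longleftrightarrow>
     loose_monad_morphism X A S S' \<phi> \<and>
     (\<exists>\<phi>'. loose_monad_morphism X A S' S \<phi>' \<and>
       \<phi>' \<bullet>\<^bsub>X\<^esub> [\<phi>] = cid X (lcarrier S) \<and> \<phi> \<bullet>\<^bsub>X\<^esub> [\<phi>'] = cid X (lcarrier S'))"

text \<open>The loose-monads \<open>E(j,T)\<close> and \<open>C(\<ell>,\<ell>)\<close>.\<close>

definition relmonad_lmonad ::
  "('o, 't, 'l, 'c) vdc \<Rightarrow> 't \<Rightarrow> ('t, 'c) relmonad \<Rightarrow> ('l, 'c) lmonad" where
  "relmonad_lmonad X j T =
     (let t = carrier T in
       \<lparr> lcarrier = hom X j t,
         lmonad_mult = smile X j t t \<bullet>\<^bsub>X\<^esub> [cid X (hom X j t), extension T],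
         lmonad_unit = hom_post X j j t (monad_unit T) \<bullet>\<^bsub>X\<^esub> [frown X j] \<rparr>)"

definition tight_lmonad :: "('o, 't, 'l, 'c) vdc \<Rightarrow> 't \<Rightarrow> ('l, 'c) lmonad" where
  "tight_lmonad X l =
     \<lparr> lcarrier = hom X l l, lmonad_mult = smile X l l l, lmonad_unit = frown X l \<rparr>"


section \<open>Relative adjunctions and resolutions\<close>

definition relative_adjunction ::
  "('o, 't, 'l, 'c) vdc \<Rightarrow> 't \<Rightarrow> 't \<Rightarrow> 't \<Rightarrow> 'c \<Rightarrow> 'c \<Rightarrow> bool" where
  "relative_adjunction X j l r sharp flat \<longleftrightarrow>
     j \<in> Tight X \<and> tight X l (tdom X j) (tcod X l) \<and> tight X r (tcod X l) (tcod X j) \<and>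
     (let p = hom X l (tid X (tcod X l)); q = hom X j r in
       gcell X sharp [p] q \<and> gcell X flat [q] p \<and>
       flat \<bullet>\<^bsub>X\<^esub> [sharp] = cid X p \<and> sharp \<bullet>\<^bsub>X\<^esub> [flat] = cid X q)"

definition induced_relmonad ::
  "('o, 't, 'l, 'c) vdc \<Rightarrow> 't \<Rightarrow> 't \<Rightarrow> 't \<Rightarrow> 'c \<Rightarrow> 'c \<Rightarrow> ('t, 'c) relmonad" where
  "induced_relmonad X j l r sharp flat =
     (let one = tid X (tcod X l) in
       \<lparr> carrier = r \<cdot>\<^bsub>X\<^esub> l,
         extension = act X r l l \<bullet>\<^bsub>X\<^esub> [restrict_right X [] j r l one flat l],
         monad_unit = restrict_right X [] l one j r sharp l \<bullet>\<^bsub>X\<^esub> [frown X l] \<rparr>)"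

definition resolution ::
  "('o, 't, 'l, 'c) vdc \<Rightarrow> 't \<Rightarrow> ('t, 'c) relmonad \<Rightarrow> 't \<Rightarrow> 't \<Rightarrow> 'c \<Rightarrow> 'c \<Rightarrow> bool" where
  "resolution X j T l r sharp flat \<longleftrightarrow>
     relative_adjunction X j l r sharp flat \<and> induced_relmonad X j l r sharp flat = T"


section \<open>Opalgebras\<close>

definition opalgebra ::
  "('o, 't, 'l, 'c) vdc \<Rightarrow> 't \<Rightarrow> ('t, 'c) relmonad \<Rightarrow> 't \<Rightarrow> 'c \<Rightarrow> bool" where
  "opalgebra X j T a lt \<longleftrightarrow>
     (let t = carrier T in
       tight X a (tdom X j) (tcod X a) \<and> gcell X lt [hom X j t] (hom X a a) \<and>
       lt \<bullet>\<^bsub>X\<^esub> [hom_post X j j t (monad_unit T) \<bullet>\<^bsub>X\<^esub> [frown X j]] = frown X a \<and>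
       smile X a a a \<bullet>\<^bsub>X\<^esub> [lt, lt] =
         lt \<bullet>\<^bsub>X\<^esub> [smile X j t t \<bullet>\<^bsub>X\<^esub> [cid X (hom X j t), extension T]])"

text \<open>The 2-cell \<open>\<rho> : B(1,a), E(j,t) \<Rightarrow> B(1,a)\<close> of an opalgebra \<open>a : A \<rightarrow> B\<close>.\<close>

definition opalgebra_action :: "('o, 't, 'l, 'c) vdc \<Rightarrow> 't \<Rightarrow> 'c \<Rightarrow> 'c" where
  "opalgebra_action X a lt =
     (let one = tid X (tcod X a) in
       smile X one a a \<bullet>\<^bsub>X\<^esub> [cid X (hom X one a), lt])"

definition graded_morphism ::
  "('o, 't, 'l, 'c) vdc \<Rightarrow> 't \<Rightarrow> ('t, 'c) relmonad \<Rightarrow> 'l list \<Rightarrow> 't \<Rightarrow> 'c \<Rightarrow> 't \<Rightarrow> 'c \<Rightarrow> 'c \<Rightarrow> bool"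
where
  "graded_morphism X j T ps a lt a' lt' \<alpha> \<longleftrightarrow>
     gcell X \<alpha> (ps @ [hom X (tid X (tcod X a)) a]) (hom X (tid X (tcod X a')) a') \<and>
     \<alpha> \<bullet>\<^bsub>X\<^esub> (map (cid X) ps @ [opalgebra_action X a lt]) =
       opalgebra_action X a' lt' \<bullet>\<^bsub>X\<^esub> [\<alpha>, cid X (hom X j (carrier T))]"

text \<open>\<open>opalgebra_factor X k ltk b a lt\<close>: the tight-cell \<open>b\<close> satisfies the defining equations of
  \<open>[]\<^bsub>(a,lt)\<^esub>\<close> with respect to \<open>(k,ltk)\<close>, namely \<open>b k = a\<close> and \<open>ltk ; b = lt\<close>.\<close>

definition opalgebra_factor ::
  "('o, 't, 'l, 'c) vdc \<Rightarrow> 't \<Rightarrow> 'c \<Rightarrow> 't \<Rightarrow> 't \<Rightarrow> 'c \<Rightarrow> bool" where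
  "opalgebra_factor X k ltk b a lt \<longleftrightarrow>
     tight X b (tcod X k) (tcod X a) \<and> b \<cdot>\<^bsub>X\<^esub> k = a \<and> act X b k k \<bullet>\<^bsub>X\<^esub> [ltk] = lt"

definition opalgebra_object ::
  "('o, 't, 'l, 'c) vdc \<Rightarrow> 't \<Rightarrow> ('t, 'c) relmonad \<Rightarrow> 't \<Rightarrow> 'c \<Rightarrow> bool" where
  "opalgebra_object X j T k ltk \<longleftrightarrow>
     opalgebra X j T k ltk \<and>
     (\<forall>a lt. opalgebra X j T a lt \<longrightarrow> (\<exists>!b. opalgebra_factor X k ltk b a lt)) \<and>
     (\<forall>ps a lt a' lt' \<alpha> b b'.
        opalgebra X j T a lt \<and> opalgebra X j T a' lt' \<and>
        graded_morphism X j T ps a lt a' lt' \<alpha> \<and>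
        opalgebra_factor X k ltk b a lt \<and> opalgebra_factor X k ltk b' a' lt' \<longrightarrow>
        (let one = tid X (tcod X a); one' = tid X (tcod X a') in
          \<exists>!\<beta>. gcell X \<beta> (ps @ [hom X one b]) (hom X one' b') \<and>
               restrict_right X ps one b one' b' \<beta> k = \<alpha>))"

end

(*
  The opalgebras of a relative monad T, and their graded morphisms, only refer to T through its
  loose-monad E(j,T), and for the trivial l-relative monad this loose-monad is C(l,l). So an
  isomorphism of loose-monads transports opalgebras, graded morphisms and the universal property of
  opalgebra objects; comparing two opalgebra objects of the same T then uses functoriality of the
  action of tight-cells on 2-cells. For a resolution, flat(1,l) : E(j,rl) => C(l,l) is invertible and
  preserves the multiplication, because every 2-cell E(j,r) => C(l,1) commutes with the right
  unitors, hence with the induced actions of the hom loose-cells C(x,y).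

  Two 2-cells into a hom loose-cell are compared after composition with the cartesian cell into the
  loose-identity, and two 2-cells out of a chain containing a loose-identity after composition with
  its unit; this turns all coherence laws into the monoid laws of the loose-identity.
*)

theory Submission
  imports Defs
begin

text \<open>The operations of the record are total and untyped, so every equation comes with
  conditions on frames. This shapes the rule set: frames are computed, and associativity is cut into
  rewrite rules that all lead to right-nested composites. Chains \<open>ps\<close> of unknown
  length, which occur only as gradings, need separate lemmas.

  Restrictions are chosen by \<open>SOME\<close>, so the chosen E(j,rl) is not literally the chosen
  restriction of E(j,r) along l; \<open>hcart\<close> mediates between them. The strict unit law for
  tight-cells, in contrast, makes C(l,1l) and C(l,l) the same loose-cell.

  For a resolution, the extension operator is flat(1,l) followed by the action of r. Hence the
  multiplication of E(j,T) is the action E(j,rl), C(l,l) \<Rightarrow> E(j,rl) with flat(1,l)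
  inserted in its second argument. Naturality of this action moves flat(1,l) into the first argument
  as well. The unit of T was built with sharp(1,l), which flat(1,l) cancels.\<close>

section \<open>Typing of composite 2-cells\<close>

text \<open>The frame of a composite is computed from its constituents, so that all typing conditions
  can be discharged by rewriting. \<open>jux_right X f \<phi>s\<close> is the right tight-cell of the juxtaposition of
  \<open>\<phi>s\<close> with left tight-cell \<open>f\<close>; \<open>layer X e \<phi>s \<chi>s\<close> distributes the cells \<open>\<chi>s\<close> over \<open>\<phi>s\<close>
  according to the lengths of the domains of \<open>\<phi>s\<close>, as in the associativity law.\<close>

fun jux_right :: "('o, 't, 'l, 'c) vdc \<Rightarrow> 't \<Rightarrow> 'c list \<Rightarrow> 't" where
  "jux_right X f [] = f"
| "jux_right X f (\<phi> # \<phi>s) = jux_right X (cright X \<phi>) \<phi>s"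

definition comp_ok :: "('o, 't, 'l, 'c) vdc \<Rightarrow> 'c \<Rightarrow> 't \<Rightarrow> 'c list \<Rightarrow> bool" where
  "comp_ok X \<psi> f \<phi>s \<longleftrightarrow> composable X \<psi> f \<phi>s (jux_right X f \<phi>s)"

fun layer :: "('o, 't, 'l, 'c) vdc \<Rightarrow> 't \<Rightarrow> 'c list \<Rightarrow> 'c list \<Rightarrow> 'c list" where
  "layer X e [] \<chi>s = []"
| "layer X e (\<phi> # \<phi>s) \<chi>s =
     ccomp X \<phi> e (take (length (csrc X \<phi>)) \<chi>s) #
     layer X (jux_right X e (take (length (csrc X \<phi>)) \<chi>s)) \<phi>s (drop (length (csrc X \<phi>)) \<chi>s)"

text \<open>The base case demands that no cell is left over, so the blocks cut off by
  \<open>take\<close> exhaust \<open>\<chi>s\<close>.\<close>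

fun layer_ok :: "('o, 't, 'l, 'c) vdc \<Rightarrow> 't \<Rightarrow> 'c list \<Rightarrow> 'c list \<Rightarrow> bool" where
  "layer_ok X e [] \<chi>s \<longleftrightarrow> \<chi>s = []"
| "layer_ok X e (\<phi> # \<phi>s) \<chi>s \<longleftrightarrow>
     comp_ok X \<phi> e (take (length (csrc X \<phi>)) \<chi>s) \<and>
     layer_ok X (jux_right X e (take (length (csrc X \<phi>)) \<chi>s)) \<phi>s (drop (length (csrc X \<phi>)) \<chi>s)"

lemma juxtaposable_jux_right: "juxtaposable X f \<phi>s g \<Longrightarrow> g = jux_right X f \<phi>s"
  by (induction X f \<phi>s g rule: juxtaposable.induct) auto

lemma composable_iff_comp_ok: "composable X \<psi> f \<phi>s g \<longleftrightarrow> comp_ok X \<psi> f \<phi>s \<and> g = jux_right X f \<phi>s"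
  unfolding comp_ok_def composable_def using juxtaposable_jux_right by metis

text \<open>Passes from the recursive form to the indexed form of the associativity law:
  \<open>\<chi>ss\<close> lists the blocks, and \<open>es\<close> the tight-cells at their
  boundaries, hence one more entry than there are blocks.\<close>

lemma layer_ok_splitting:
  assumes "layer_ok X e \<phi>s \<chi>s"
  shows "\<exists>es \<chi>ss. length \<chi>ss = length \<phi>s \<and> length es = Suc (length \<phi>s) \<and> es ! 0 = e \<and>
    concat \<chi>ss = \<chi>s \<and>
    (\<forall>i<length \<phi>s. composable X (\<phi>s ! i) (es ! i) (\<chi>ss ! i) (es ! Suc i)) \<and>
    layer X e \<phi>s \<chi>s = map (\<lambda>i. ccomp X (\<phi>s ! i) (es ! i) (\<chi>ss ! i)) [0..<length \<phi>s]"
  using assms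
proof (induction X e \<phi>s \<chi>s rule: layer_ok.induct)
  case (1 X e \<chi>s)
  then show ?case by (intro exI[of _ "[e]"] exI[of _ "[]"]) auto
next
  case (2 X e \<phi> \<phi>s \<chi>s)
  let ?n = "length (csrc X \<phi>)"
  from 2 obtain es \<chi>ss where h: "length \<chi>ss = length \<phi>s" "length es = Suc (length \<phi>s)"
    "es ! 0 = jux_right X e (take ?n \<chi>s)" "concat \<chi>ss = drop ?n \<chi>s"
    "\<forall>i<length \<phi>s. composable X (\<phi>s ! i) (es ! i) (\<chi>ss ! i) (es ! Suc i)"
    "layer X (jux_right X e (take ?n \<chi>s)) \<phi>s (drop ?n \<chi>s) =
       map (\<lambda>i. ccomp X (\<phi>s ! i) (es ! i) (\<chi>ss ! i)) [0..<length \<phi>s]"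
    by auto
  show ?case
  proof (intro exI[of _ "e # es"] exI[of _ "take ?n \<chi>s # \<chi>ss"] conjI allI impI)
    fix i assume "i < length (\<phi> # \<phi>s)"
    then show "composable X ((\<phi> # \<phi>s) ! i) ((e # es) ! i) ((take ?n \<chi>s # \<chi>ss) ! i) ((e # es) ! Suc i)"
      using h 2 by (cases i) (auto simp: composable_iff_comp_ok)
  next
    show "layer X e (\<phi> # \<phi>s) \<chi>s = map (\<lambda>i. ccomp X ((\<phi> # \<phi>s) ! i) ((e # es) ! i)
        ((take ?n \<chi>s # \<chi>ss) ! i)) [0..<length (\<phi> # \<phi>s)]"
      using h by (simp add: map_upt_Suc del: upt_Suc)
  qed (use h in auto)
qed

context virtual_double_category
begin

lemma tid_Tight [simp]: "A \<in> Obj X \<Longrightarrow> tid X A \<in> Tight X"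
  and tdom_tid [simp]: "A \<in> Obj X \<Longrightarrow> tdom X (tid X A) = A"
  and tcod_tid [simp]: "A \<in> Obj X \<Longrightarrow> tcod X (tid X A) = A"
  using tid_tight by (auto simp: tight_def)

lemma tdom_Obj [simp]: "f \<in> Tight X \<Longrightarrow> tdom X f \<in> Obj X"
  and tcod_Obj [simp]: "f \<in> Tight X \<Longrightarrow> tcod X f \<in> Obj X"
  using tight_frame by auto

lemma ldom_Obj [simp]: "p \<in> Loose X \<Longrightarrow> ldom X p \<in> Obj X"
  and lcod_Obj [simp]: "p \<in> Loose X \<Longrightarrow> lcod X p \<in> Obj X"
  using loose_frame by auto

lemma tcomp_Tight [simp]: "\<lbrakk>f \<in> Tight X; g \<in> Tight X; tcod X f = tdom X g\<rbrakk> \<Longrightarrow> g \<cdot> f \<in> Tight X"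
  and tdom_tcomp [simp]: "\<lbrakk>f \<in> Tight X; g \<in> Tight X; tcod X f = tdom X g\<rbrakk> \<Longrightarrow> tdom X (g \<cdot> f) = tdom X f"
  and tcod_tcomp [simp]: "\<lbrakk>f \<in> Tight X; g \<in> Tight X; tcod X f = tdom X g\<rbrakk> \<Longrightarrow> tcod X (g \<cdot> f) = tcod X g"
  using tcomp_tight[of f "tdom X f" "tcod X f" g "tcod X g"] by (auto simp: tight_def)

lemma tcomp_tid [simp]:
  "\<lbrakk>f \<in> Tight X; tdom X f = A\<rbrakk> \<Longrightarrow> f \<cdot> tid X A = f"
  "\<lbrakk>f \<in> Tight X; tcod X f = A\<rbrakk> \<Longrightarrow> tid X A \<cdot> f = f"
  using tcomp_tid_right tcomp_tid_left by (auto simp: tight_def)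

lemma tcomp_assoc_simp [simp]:
  "\<lbrakk>f \<in> Tight X; g \<in> Tight X; h \<in> Tight X; tcod X f = tdom X g; tcod X g = tdom X h\<rbrakk> \<Longrightarrow>
    h \<cdot> g \<cdot> f = h \<cdot> (g \<cdot> f)"
  using tcomp_assoc by (auto simp: tight_def)

lemma cell_frameD:
  assumes "\<phi> \<in> Cell X"
  shows "ctgt X \<phi> \<in> Loose X" "cleft X \<phi> \<in> Tight X" "cright X \<phi> \<in> Tight X"
    "tcod X (cleft X \<phi>) = lcod X (ctgt X \<phi>)" "tcod X (cright X \<phi>) = ldom X (ctgt X \<phi>)"
    "chain X (tdom X (cleft X \<phi>)) (csrc X \<phi>) (tdom X (cright X \<phi>))"
  using cell_frame[of \<phi> "csrc X \<phi>" "ctgt X \<phi>" "cleft X \<phi>" "cright X \<phi>"] assms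
  by (auto simp: cell_def tight_def)

lemmas cell_frame_simps [simp] = cell_frameD(1-5)

text \<open>In the second clause the codomain condition on \<open>f\<close> is implied: the target
  of the first cell is the first loose-cell in the source of \<open>\<psi>\<close>. For the empty
  list nothing else ties \<open>f\<close> to \<open>\<psi>\<close>, so there the condition
  stays.\<close>

lemma comp_ok_simps:
  "comp_ok X \<psi> f [] \<longleftrightarrow> \<psi> \<in> Cell X \<and> f \<in> Tight X \<and> csrc X \<psi> = [] \<and> tcod X f = tdom X (cleft X \<psi>)"
  "comp_ok X \<psi> f (\<phi> # \<phi>s) \<longleftrightarrow> \<psi> \<in> Cell X \<and> juxtaposable X f (\<phi> # \<phi>s) (jux_right X f (\<phi> # \<phi>s)) \<and>
     ctgt X \<phi> # map (ctgt X) \<phi>s = csrc X \<psi>"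
proof -
  show "comp_ok X \<psi> f [] \<longleftrightarrow> \<psi> \<in> Cell X \<and> f \<in> Tight X \<and> csrc X \<psi> = [] \<and> tcod X f = tdom X (cleft X \<psi>)"
    by (auto simp: comp_ok_def composable_def)
  have "lcod X (ctgt X \<phi>) = tdom X (cleft X \<psi>)" if "\<psi> \<in> Cell X" "ctgt X \<phi> # map (ctgt X) \<phi>s = csrc X \<psi>"
    using cell_frameD(6)[OF that(1)] that(2)[symmetric] by simp
  then show "comp_ok X \<psi> f (\<phi> # \<phi>s) \<longleftrightarrow> \<psi> \<in> Cell X \<and> juxtaposable X f (\<phi> # \<phi>s) (jux_right X f (\<phi> # \<phi>s)) \<and>
     ctgt X \<phi> # map (ctgt X) \<phi>s = csrc X \<psi>"
    by (auto simp: comp_ok_def composable_def)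
qed

lemma ccomp_frame [simp]:
  assumes "comp_ok X \<psi> f \<phi>s"
  shows "ccomp X \<psi> f \<phi>s \<in> Cell X" "csrc X (ccomp X \<psi> f \<phi>s) = concat (map (csrc X) \<phi>s)"
    "ctgt X (ccomp X \<psi> f \<phi>s) = ctgt X \<psi>" "cleft X (ccomp X \<psi> f \<phi>s) = cleft X \<psi> \<cdot> f"
    "cright X (ccomp X \<psi> f \<phi>s) = cright X \<psi> \<cdot> jux_right X f \<phi>s"
  using ccomp_cell assms by (auto simp: cell_def comp_ok_def)

text \<open>The first cell of the layer fixes the position of \<open>e\<close>. An empty
  \<open>\<phi>s\<close> would leave \<open>e\<close> unconstrained, which is why the nullary case
  of associativity carries its own conditions on \<open>e\<close>.\<close>

lemma layer_ok_tcod: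
  assumes "comp_ok X \<psi> f \<phi>s" "layer_ok X e \<phi>s \<chi>s" "\<phi>s \<noteq> []"
  shows "e \<in> Tight X" "tcod X e = tdom X f"
proof -
  obtain \<phi> \<phi>s' where p: "\<phi>s = \<phi> # \<phi>s'" using assms(3) by (cases \<phi>s) auto
  have "comp_ok X \<phi> e (take (length (csrc X \<phi>)) \<chi>s)" "cleft X \<phi> = f"
    using assms p by (auto simp: comp_ok_simps)
  then show "e \<in> Tight X" "tcod X e = tdom X f"
    by (cases "take (length (csrc X \<phi>)) \<chi>s"; auto simp: comp_ok_def composable_def)+
qed

lemma ccomp_ccomp:
  assumes "comp_ok X \<psi> f \<phi>s" "layer_ok X e \<phi>s \<chi>s" "e \<in> Tight X" "tcod X e = tdom X f"
  shows "ccomp X (ccomp X \<psi> f \<phi>s) e \<chi>s = ccomp X \<psi> (f \<cdot> e) (layer X e \<phi>s \<chi>s)"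
proof -
  obtain es \<chi>ss where h: "length \<chi>ss = length \<phi>s" "length es = Suc (length \<phi>s)" "es ! 0 = e"
    "concat \<chi>ss = \<chi>s"
    "\<And>i. i<length \<phi>s \<Longrightarrow> composable X (\<phi>s ! i) (es ! i) (\<chi>ss ! i) (es ! Suc i)"
    "layer X e \<phi>s \<chi>s = map (\<lambda>i. ccomp X (\<phi>s ! i) (es ! i) (\<chi>ss ! i)) [0..<length \<phi>s]"
    using layer_ok_splitting[OF assms(2)] by auto
  from ccomp_assoc[of \<psi> f \<phi>s "jux_right X f \<phi>s" \<chi>ss es] h assms show ?thesis
    by (auto simp: comp_ok_def)
qed

lemma ccomp_ccomp_nil [simp]:
  "\<lbrakk>comp_ok X \<psi> f []; e \<in> Tight X; tcod X e = tdom X f\<rbrakk> \<Longrightarrow>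
    ccomp X (ccomp X \<psi> f []) e [] = ccomp X \<psi> (f \<cdot> e) []"
  by (subst ccomp_ccomp) auto

text \<open>With a single middle cell the only block is all of \<open>\<chi>s\<close>, so no
  \<open>take\<close> or \<open>drop\<close> has to be evaluated and the rule also fires for a list
  variable.\<close>

lemma ccomp_ccomp_unary [simp]:
  assumes "comp_ok X \<psi> f [\<phi>]" "comp_ok X \<phi> e \<chi>s"
  shows "ccomp X (ccomp X \<psi> f [\<phi>]) e \<chi>s = ccomp X \<psi> (f \<cdot> e) [ccomp X \<phi> e \<chi>s]"
proof -
  have "length \<chi>s = length (csrc X \<phi>)"
    using assms(2) by (metis comp_ok_def composable_def length_map)
  then have "layer_ok X e [\<phi>] \<chi>s" "layer X e [\<phi>] \<chi>s = [ccomp X \<phi> e \<chi>s]" using assms by simp_all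
  then show ?thesis using layer_ok_tcod ccomp_ccomp assms(1) by (metis not_Cons_self2)
qed

lemma ccomp_ccomp_cons [simp]:
  assumes "comp_ok X \<psi> f (\<phi> # \<phi>' # \<phi>s)" "layer_ok X e (\<phi> # \<phi>' # \<phi>s) \<chi>s"
  shows "ccomp X (ccomp X \<psi> f (\<phi> # \<phi>' # \<phi>s)) e \<chi>s =
    ccomp X \<psi> (f \<cdot> e) (layer X e (\<phi> # \<phi>' # \<phi>s) \<chi>s)"
  using layer_ok_tcod[OF assms] ccomp_ccomp assms by blast

lemma cid_frame [simp]:
  assumes "p \<in> Loose X"
  shows "cid X p \<in> Cell X" "csrc X (cid X p) = [p]" "ctgt X (cid X p) = p"
    "cleft X (cid X p) = tid X (lcod X p)" "cright X (cid X p) = tid X (ldom X p)"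
  using cid_gcell[OF assms] by (auto simp: gcell_def cell_def)

lemma ccomp_cid [simp]:
  "\<lbrakk>\<phi> \<in> Cell X; ctgt X \<phi> = p; cleft X \<phi> = f\<rbrakk> \<Longrightarrow> ccomp X (cid X p) f [\<phi>] = \<phi>"
  using ccomp_cid_left by auto

lemma ccomp_cids:
  "\<lbrakk>\<psi> \<in> Cell X; csrc X \<psi> = ps; tdom X (cleft X \<psi>) = A\<rbrakk> \<Longrightarrow>
    ccomp X \<psi> (tid X A) (map (cid X) ps) = \<psi>"
  using ccomp_cid_right by auto

text \<open>Simplification turns \<open>map (cid X)\<close> on a displayed chain into a displayed
  list; these are the lengths that occur.\<close>

lemma ccomp_cids_literal [simp]:
  "\<lbrakk>\<psi> \<in> Cell X; csrc X \<psi> = []; tdom X (cleft X \<psi>) = A\<rbrakk> \<Longrightarrow> ccomp X \<psi> (tid X A) [] = \<psi>"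
  "\<lbrakk>\<psi> \<in> Cell X; csrc X \<psi> = [p]; tdom X (cleft X \<psi>) = A\<rbrakk> \<Longrightarrow> ccomp X \<psi> (tid X A) [cid X p] = \<psi>"
  "\<lbrakk>\<psi> \<in> Cell X; csrc X \<psi> = [p, q]; tdom X (cleft X \<psi>) = A\<rbrakk> \<Longrightarrow>
     ccomp X \<psi> (tid X A) [cid X p, cid X q] = \<psi>"
  using ccomp_cids[of \<psi> _ A] by (metis list.map)+

end

section \<open>Universal properties of loose-identities and of hom loose-cells\<close>

context virtual_equipment
begin

lemma lunit_is_lunit: "A \<in> Obj X \<Longrightarrow> is_lunit X A (lunit X A)"
  unfolding lunit_def using loose_identities by (rule someI_ex)

lemma lunit_frame [simp]:
  assumes "A \<in> Obj X"
  shows "lunit X A \<in> Cell X" "csrc X (lunit X A) = []" "ctgt X (lunit X A) = lid X A"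
    "cleft X (lunit X A) = tid X A" "cright X (lunit X A) = tid X A"
    "lid X A \<in> Loose X" "ldom X (lid X A) = A" "lcod X (lid X A) = A"
proof -
  obtain p where p: "ldom X p = A" "lcod X p = A" "gcell X (lunit X A) [] p"
    using lunit_is_lunit[OF assms] by (auto simp: is_lunit_def)
  then show *: "lunit X A \<in> Cell X" "csrc X (lunit X A) = []" "ctgt X (lunit X A) = lid X A"
    "cleft X (lunit X A) = tid X A" "cright X (lunit X A) = tid X A"
    "ldom X (lid X A) = A" "lcod X (lid X A) = A"
    by (auto simp: gcell_def cell_def lid_def)
  show "lid X A \<in> Loose X" using cell_frameD(1)[OF *(1)] *(3) by simp
qed

lemma lunit_factor:
  assumes "A \<in> Obj X" "chain X (tdom X (cleft X \<psi>)) ps A" "chain X A rs (tdom X (cright X \<psi>))"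
    "\<psi> \<in> Cell X" "csrc X \<psi> = ps @ rs"
  shows "\<exists>!\<psi>'. cell X \<psi>' (ps @ [lid X A] @ rs) (ctgt X \<psi>) (cleft X \<psi>) (cright X \<psi>) \<and>
    ccomp X \<psi>' (tid X (tdom X (cleft X \<psi>))) (map (cid X) ps @ [lunit X A] @ map (cid X) rs) = \<psi>"
proof -
  obtain qs q where q: "gcell X (lunit X A) qs q" and
    ex: "\<And>ps rs s f g \<psi>.
          chain X (tdom X f) ps (lcod X q) \<Longrightarrow> chain X (ldom X q) rs (tdom X g) \<Longrightarrow>
          cell X \<psi> (ps @ qs @ rs) s f g \<Longrightarrow>
          (\<exists>!\<psi>'. cell X \<psi>' (ps @ [q] @ rs) s f g \<and>
            ccomp X \<psi>' (tid X (tdom X f)) (map (cid X) ps @ [lunit X A] @ map (cid X) rs) = \<psi>)"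
    using lunit_is_lunit[OF assms(1)] unfolding is_lunit_def opcartesian_def by blast
  \<comment> \<open>A cell determines its frame, which fixes the existentially bound
    \<open>qs\<close> and \<open>q\<close>.\<close>
  have "qs = []" "q = lid X A" using q assms(1) by (auto simp: gcell_def cell_def)
  then show ?thesis
    using ex[of "cleft X \<psi>" ps rs "cright X \<psi>" \<psi> "ctgt X \<psi>"] assms by (simp add: cell_def)
qed

lemma rcell_is_rcell:
  "\<lbrakk>q \<in> Loose X; f \<in> Tight X; g \<in> Tight X; tcod X f = lcod X q; tcod X g = ldom X q\<rbrakk> \<Longrightarrow>
    is_rcell X q f g (rcell X q f g)"
  unfolding rcell_def using restrictions by (rule someI_ex)

lemma hcell_is_rcell:
  "\<lbrakk>f \<in> Tight X; g \<in> Tight X; tcod X f = tcod X g\<rbrakk> \<Longrightarrow>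
    is_rcell X (lid X (tcod X g)) f g (hcell X f g)"
  unfolding hcell_def by (simp add: rcell_is_rcell)

lemma hcell_frame [simp]:
  assumes "f \<in> Tight X" "g \<in> Tight X" "tcod X f = tcod X g"
  shows "hcell X f g \<in> Cell X" "csrc X (hcell X f g) = [hom X f g]"
    "ctgt X (hcell X f g) = lid X (tcod X g)" "cleft X (hcell X f g) = f" "cright X (hcell X f g) = g"
    "hom X f g \<in> Loose X" "lcod X (hom X f g) = tdom X f" "ldom X (hom X f g) = tdom X g"
proof -
  obtain p where "cell X (hcell X f g) [p] (lid X (tcod X g)) f g"
    using hcell_is_rcell[OF assms] by (auto simp: is_rcell_def)
  then show *: "hcell X f g \<in> Cell X" "csrc X (hcell X f g) = [hom X f g]"
    "ctgt X (hcell X f g) = lid X (tcod X g)" "cleft X (hcell X f g) = f" "cright X (hcell X f g) = g"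
    by (auto simp: cell_def hom_def res_def hcell_def)
  show "hom X f g \<in> Loose X" "lcod X (hom X f g) = tdom X f" "ldom X (hom X f g) = tdom X g"
    using cell_frameD(6)[OF *(1)] * by auto
qed

lemma hcell_factor:
  assumes "f \<in> Tight X" "g \<in> Tight X" "tcod X f = tcod X g" "f' \<in> Tight X" "g' \<in> Tight X"
    "tcod X f' = tdom X f" "tcod X g' = tdom X g"
    "\<psi> \<in> Cell X" "ctgt X \<psi> = lid X (tcod X g)" "cleft X \<psi> = f \<cdot> f'" "cright X \<psi> = g \<cdot> g'"
  shows "\<exists>!\<chi>. cell X \<chi> (csrc X \<psi>) (hom X f g) f' g' \<and> ccomp X (hcell X f g) f' [\<chi>] = \<psi>"
proof -
  obtain p0 q0 f0 g0 where q: "cell X (hcell X f g) [p0] q0 f0 g0" and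
    ex: "\<And>f' g' ps \<psi>.
          tight X f' (tdom X f') (tdom X f0) \<and> tight X g' (tdom X g') (tdom X g0) \<and>
          cell X \<psi> ps q0 (f0 \<cdot> f') (g0 \<cdot> g') \<Longrightarrow>
          (\<exists>!\<chi>. cell X \<chi> ps p0 f' g' \<and> ccomp X (hcell X f g) f' [\<chi>] = \<psi>)"
    using hcell_is_rcell[OF assms(1-3)] unfolding is_rcell_def cartesian_def by blast
  have "p0 = hom X f g" "q0 = lid X (tcod X g)" "f0 = f" "g0 = g"
    using q assms(1-3) by (auto simp: cell_def)
  then show ?thesis
    using ex[of f' g' \<psi> "csrc X \<psi>"] assms by (simp add: cell_def tight_def)
qed

lemma hcell_mono:
  assumes "f \<in> Tight X" "g \<in> Tight X" "tcod X f = tcod X g"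
    "\<chi> \<in> Cell X" "\<chi>' \<in> Cell X" "ctgt X \<chi> = hom X f g" "ctgt X \<chi>' = hom X f g"
    "csrc X \<chi> = csrc X \<chi>'" "cleft X \<chi> = cleft X \<chi>'" "cright X \<chi> = cright X \<chi>'"
    "ccomp X (hcell X f g) (cleft X \<chi>) [\<chi>] = ccomp X (hcell X f g) (cleft X \<chi>) [\<chi>']"
  shows "\<chi> = \<chi>'"
proof -
  have *: "tcod X (cleft X \<chi>') = tdom X f" "tcod X (cright X \<chi>') = tdom X g"
    using assms cell_frameD(4,5)[of \<chi>'] by simp_all
  have comp_ok: "comp_ok X (hcell X f g) (cleft X \<chi>') [\<chi>']" using assms by (simp add: comp_ok_simps)
  have "\<exists>!\<xi>. cell X \<xi> (csrc X \<chi>') (hom X f g) (cleft X \<chi>') (cright X \<chi>') \<and>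
      ccomp X (hcell X f g) (cleft X \<chi>') [\<xi>] = ccomp X (hcell X f g) (cleft X \<chi>') [\<chi>']"
    using hcell_factor[of f g "cleft X \<chi>'" "cright X \<chi>'" "ccomp X (hcell X f g) (cleft X \<chi>') [\<chi>']"]
      assms(1-3,5) * comp_ok by simp
  then show ?thesis using assms by (auto simp: cell_def)
qed

end

section \<open>Composition of hom loose-cells\<close>

lemma juxtaposable_append:
  "juxtaposable X f \<phi>s g \<Longrightarrow> juxtaposable X g \<psi>s h \<Longrightarrow> juxtaposable X f (\<phi>s @ \<psi>s) h"
  by (induction X f \<phi>s g rule: juxtaposable.induct) auto

lemma gcell_iff: "gcell X \<phi> ps q \<longleftrightarrow> \<phi> \<in> Cell X \<and> csrc X \<phi> = ps \<and> ctgt X \<phi> = q \<and>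
    cleft X \<phi> = tid X (lcod X q) \<and> cright X \<phi> = tid X (ldom X q)"
  by (simp add: gcell_def cell_def)

context virtual_double_category
begin

lemma chain_appendD: "chain X A (ps @ qs) C \<Longrightarrow> \<exists>B. chain X A ps B \<and> chain X B qs C"
proof (induction ps arbitrary: A)
  case Nil
  then have "A \<in> Obj X" by (cases qs) (auto simp: loose_frame)
  with Nil show ?case by simp
qed simp

lemma chain_Obj: "chain X A ps B \<Longrightarrow> A \<in> Obj X \<and> B \<in> Obj X"
  by (induction ps arbitrary: A) auto

lemma juxtaposable_cids: "chain X A ps B \<Longrightarrow> juxtaposable X (tid X A) (map (cid X) ps) (tid X B)"
  by (induction ps arbitrary: A) auto

lemma map_ctgt_cids: "chain X A ps B \<Longrightarrow> map (ctgt X) (map (cid X) ps) = ps"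
  by (induction ps arbitrary: A) auto

lemma concat_csrc_cids: "chain X A ps B \<Longrightarrow> concat (map (csrc X) (map (cid X) ps)) = ps"
  by (induction ps arbitrary: A) auto

end

context virtual_equipment
begin

text \<open>The uniqueness half of \<open>lunit_factor\<close>. The endpoints of \<open>ps\<close>
  and \<open>rs\<close> are recovered from the frame of \<open>\<theta>\<close>, so an application
  only has to display the position of the loose-identity in the source.\<close>

lemma lunit_cancel:
  assumes "A \<in> Obj X" "\<theta> \<in> Cell X" "\<theta>' \<in> Cell X" "csrc X \<theta> = ps @ [lid X A] @ rs"
    "csrc X \<theta>' = csrc X \<theta>" "ctgt X \<theta> = ctgt X \<theta>'" "cleft X \<theta> = cleft X \<theta>'"
    "cright X \<theta> = cright X \<theta>'" "tdom X (cleft X \<theta>) = B"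
    and eq: "ccomp X \<theta> (tid X B) (map (cid X) ps @ [lunit X A] @ map (cid X) rs) =
      ccomp X \<theta>' (tid X B) (map (cid X) ps @ [lunit X A] @ map (cid X) rs)"
  shows "\<theta> = \<theta>'"
proof -
  let ?D = "tdom X (cright X \<theta>)" and ?\<phi>s = "map (cid X) ps @ [lunit X A] @ map (cid X) rs"
  have "chain X B (ps @ [lid X A] @ rs) ?D"
    using cell_frameD(6)[OF assms(2)] assms(4,9) by simp
  then obtain C where "chain X B ps C" "chain X C ([lid X A] @ rs) ?D"
    by (blast dest: chain_appendD)
  then have ch: "chain X B ps A" "chain X A rs ?D" using assms(1) by auto
  have jux: "juxtaposable X (tid X B) ?\<phi>s (tid X ?D)"
    using juxtaposable_cids[OF ch(1)] juxtaposable_cids[OF ch(2)] assms(1)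
    by (intro juxtaposable_append) auto
  moreover have "jux_right X (tid X B) ?\<phi>s = tid X ?D"
    using juxtaposable_jux_right[OF jux] by simp
  moreover have "B \<in> Obj X" using ch chain_Obj by blast
  ultimately have comp_ok: "comp_ok X \<theta> (tid X B) ?\<phi>s"
    using assms(1,2,4,9) map_ctgt_cids[OF ch(1)] map_ctgt_cids[OF ch(2)]
    by (simp add: comp_ok_def composable_def)
  let ?\<psi> = "ccomp X \<theta> (tid X B) ?\<phi>s"
  have fr: "cleft X ?\<psi> = cleft X \<theta>" "cright X ?\<psi> = cright X \<theta>" "ctgt X ?\<psi> = ctgt X \<theta>"
    "csrc X ?\<psi> = ps @ rs" "?\<psi> \<in> Cell X"
    using comp_ok \<open>jux_right X (tid X B) ?\<phi>s = tid X ?D\<close> assms(1,2,9)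
      concat_csrc_cids[OF ch(1)] concat_csrc_cids[OF ch(2)] by simp_all
  have "\<exists>!\<psi>'. cell X \<psi>' (ps @ [lid X A] @ rs) (ctgt X \<theta>) (cleft X \<theta>) (cright X \<theta>) \<and>
    ccomp X \<psi>' (tid X B) ?\<phi>s = ?\<psi>"
    using lunit_factor[of A ?\<psi> ps rs] unfolding fr using assms(1,9) ch fr(5) by simp
  then show ?thesis using assms by (auto simp: cell_def)
qed

section \<open>The loose-identity as a monoid\<close>

lemma lmult_props:
  assumes "E \<in> Obj X"
  shows lmult_frame [simp]: "lmult X E \<in> Cell X" "csrc X (lmult X E) = [lid X E, lid X E]"
    "ctgt X (lmult X E) = lid X E" "cleft X (lmult X E) = tid X E" "cright X (lmult X E) = tid X E"
    and lmult_lunit_left: "ccomp X (lmult X E) (tid X E) [lunit X E, cid X (lid X E)] = cid X (lid X E)"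
proof -
  have "\<exists>!m. gcell X m [lid X E, lid X E] (lid X E) \<and>
       m \<bullet> [lunit X E, cid X (lid X E)] = cid X (lid X E)"
  proof -
    \<comment> \<open>The defining description becomes a factorisation problem for
      \<open>lunit_factor\<close>: the cell to be factored is the identity of
      \<open>lid X E\<close>, with the new loose-identity inserted in front.\<close>
    have "(gcell X m [lid X E, lid X E] (lid X E) \<and>
        m \<bullet> [lunit X E, cid X (lid X E)] = cid X (lid X E)) \<longleftrightarrow>
      cell X m ([] @ [lid X E] @ [lid X E]) (ctgt X (cid X (lid X E))) (cleft X (cid X (lid X E)))
        (cright X (cid X (lid X E))) \<and>
      ccomp X m (tid X (tdom X (cleft X (cid X (lid X E)))))
        (map (cid X) [] @ [lunit X E] @ map (cid X) [lid X E]) = cid X (lid X E)" for m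
      using assms by (auto simp: cell_def gcell_def gcomp_def)
    then show ?thesis
      using lunit_factor[of E "cid X (lid X E)" "[]" "[lid X E]"] assms by simp
  qed
  from theI'[OF this] show
    "lmult X E \<in> Cell X" "csrc X (lmult X E) = [lid X E, lid X E]"
    "ctgt X (lmult X E) = lid X E" "cleft X (lmult X E) = tid X E" "cright X (lmult X E) = tid X E"
    "ccomp X (lmult X E) (tid X E) [lunit X E, cid X (lid X E)] = cid X (lid X E)"
    using assms unfolding lmult_def[symmetric] by (auto simp: gcell_iff gcomp_def)
qed

text \<open>A cell out of the loose-identity is determined by its composite with
  \<open>lunit\<close>. Here both composites are \<open>lunit\<close>: the multiplication applied to
  two units is evaluated by the left unit law.\<close>

lemma lmult_lunit_right:
  assumes "E \<in> Obj X"
  shows "ccomp X (lmult X E) (tid X E) [cid X (lid X E), lunit X E] = cid X (lid X E)"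
proof -
  have "ccomp X (ccomp X (lmult X E) (tid X E) [lunit X E, cid X (lid X E)]) (tid X E) [lunit X E] =
      lunit X E"
    using assms by (subst lmult_lunit_left) simp_all
  with assms show ?thesis
    by - (rule lunit_cancel[where ps="[]" and rs="[]" and A=E and B=E], simp_all add: comp_ok_simps)
qed

text \<open>The unit laws precomposed with \<open>\<phi>\<close>. The nullary unit then carries the
  adjacent tight-cell of \<open>\<phi>\<close> as a datum of its own, whence
  \<open>ccomp X (lunit X E) f []\<close>.\<close>

lemma lmult_unit [simp]:
  assumes "\<phi> \<in> Cell X" "ctgt X \<phi> = lid X E" "E \<in> Obj X"
  shows "cleft X \<phi> = f \<Longrightarrow> ccomp X (lmult X E) f [ccomp X (lunit X E) f [], \<phi>] = \<phi>"
    and "cleft X \<phi> = f \<Longrightarrow> cright X \<phi> = g \<Longrightarrow> ccomp X (lmult X E) f [\<phi>, ccomp X (lunit X E) g []] = \<phi>"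
proof -
  have fr: "tcod X (cleft X \<phi>) = E" "tcod X (cright X \<phi>) = E" "cleft X \<phi> \<in> Tight X"
    "cright X \<phi> \<in> Tight X"
    using assms by simp_all
  have "ccomp X (ccomp X (lmult X E) (tid X E) [lunit X E, cid X (lid X E)]) (cleft X \<phi>) [\<phi>] = \<phi>"
    using assms by (subst lmult_lunit_left) simp_all
  then show "cleft X \<phi> = f \<Longrightarrow> ccomp X (lmult X E) f [ccomp X (lunit X E) f [], \<phi>] = \<phi>"
    using assms fr by (simp add: comp_ok_simps)
  have "ccomp X (ccomp X (lmult X E) (tid X E) [cid X (lid X E), lunit X E]) (cleft X \<phi>) [\<phi>] = \<phi>"
    using assms by (subst lmult_lunit_right) simp_all
  then show "cleft X \<phi> = f \<Longrightarrow> cright X \<phi> = g \<Longrightarrow> ccomp X (lmult X E) f [\<phi>, ccomp X (lunit X E) g []] = \<phi>"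
    using assms fr by (simp add: comp_ok_simps)
qed

text \<open>After insertion of a unit in the first place, both sides reduce to
  \<open>lmult X E\<close> by the left unit law.\<close>

lemma lmult_lmult:
  assumes "E \<in> Obj X"
  shows "ccomp X (lmult X E) (tid X E) [lmult X E, cid X (lid X E)] =
    ccomp X (lmult X E) (tid X E) [cid X (lid X E), lmult X E]"
proof -
  have *: "ccomp X (lmult X E) (tid X E) [lunit X E, lmult X E] = lmult X E"
    using lmult_unit(1)[of "lmult X E" E "tid X E"] assms by simp
  show ?thesis
    using assms * lmult_lunit_left
    by - (rule lunit_cancel[where ps="[]" and rs="[lid X E, lid X E]" and A=E and B=E], simp_all add: comp_ok_simps)
qed

lemma lmult_assoc [simp]:
  assumes "\<phi> \<in> Cell X" "\<phi>' \<in> Cell X" "\<phi>'' \<in> Cell X" "E \<in> Obj X"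
    "ctgt X \<phi> = lid X E" "ctgt X \<phi>' = lid X E" "ctgt X \<phi>'' = lid X E"
    "cleft X \<phi> = f" "cright X \<phi> = cleft X \<phi>'" "cright X \<phi>' = cleft X \<phi>''"
  shows "ccomp X (lmult X E) f [ccomp X (lmult X E) f [\<phi>, \<phi>'], \<phi>''] =
    ccomp X (lmult X E) f [\<phi>, ccomp X (lmult X E) (cleft X \<phi>') [\<phi>', \<phi>'']]"
proof -
  have fr: "tcod X (cleft X \<phi>) = E" "tcod X (cleft X \<phi>') = E" "tcod X (cleft X \<phi>'') = E"
    using assms cell_frameD(4)[of \<phi>] cell_frameD(4)[of \<phi>'] cell_frameD(4)[of \<phi>''] by simp_all
  have tl: "f \<in> Tight X" "tcod X f = E" "cleft X \<phi>' \<in> Tight X" "cleft X \<phi>'' \<in> Tight X" "cright X \<phi>'' \<in> Tight X"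
    using assms(1-3,8) fr cell_frameD(2,3)[of \<phi>] by simp_all
  have "ccomp X (ccomp X (lmult X E) (tid X E) [lmult X E, cid X (lid X E)]) f [\<phi>, \<phi>', \<phi>''] =
    ccomp X (ccomp X (lmult X E) (tid X E) [cid X (lid X E), lmult X E]) f [\<phi>, \<phi>', \<phi>'']"
    using lmult_lmult assms by simp
  then show ?thesis using assms fr tl by (simp add: comp_ok_simps)
qed

section \<open>Composition 2-cells and their units\<close>

lemma smile_props:
  assumes "x \<in> Tight X" "t \<in> Tight X" "y \<in> Tight X" "tcod X x = tcod X t" "tcod X y = tcod X t"
  shows smile_frame [simp]: "smile X x t y \<in> Cell X" "csrc X (smile X x t y) = [hom X x t, hom X t y]"
    "ctgt X (smile X x t y) = hom X x y" "cleft X (smile X x t y) = tid X (tdom X x)"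
    "cright X (smile X x t y) = tid X (tdom X y)"
    and hcell_smile: "ccomp X (hcell X x y) (tid X (tdom X x)) [smile X x t y] =
       ccomp X (lmult X (tcod X t)) x [hcell X x t, hcell X t y]"
proof -
  have "\<exists>!\<sigma>. gcell X \<sigma> [hom X x t, hom X t y] (hom X x y) \<and>
       ccomp X (hcell X x y) (tid X (tdom X x)) [\<sigma>] =
       ccomp X (lmult X (tcod X t)) x [hcell X x t, hcell X t y]"
    using hcell_factor[of x y "tid X (tdom X x)" "tid X (tdom X y)"
      "ccomp X (lmult X (tcod X t)) x [hcell X x t, hcell X t y]"] assms
    by (simp add: comp_ok_simps gcell_def)
  from theI'[OF this] show "smile X x t y \<in> Cell X" "csrc X (smile X x t y) = [hom X x t, hom X t y]"
    "ctgt X (smile X x t y) = hom X x y" "cleft X (smile X x t y) = tid X (tdom X x)"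
    "cright X (smile X x t y) = tid X (tdom X y)"
    "ccomp X (hcell X x y) (tid X (tdom X x)) [smile X x t y] =
       ccomp X (lmult X (tcod X t)) x [hcell X x t, hcell X t y]"
    using assms unfolding smile_def[symmetric] by (auto simp: gcell_iff)
qed

text \<open>The form of \<open>hcell_smile\<close> that matches right-nested composites. It replaces
  each \<open>smile\<close> under a cartesian cell by \<open>lmult\<close>, so that associativity of
  \<open>smile\<close> becomes \<open>lmult_assoc\<close>.\<close>

lemma hcell_smile_ccomp [simp]:
  assumes "x \<in> Tight X" "t \<in> Tight X" "y \<in> Tight X" "tcod X x = tcod X t" "tcod X y = tcod X t"
    "comp_ok X (smile X x t y) e [\<phi>, \<phi>']"
  shows "ccomp X (hcell X x y) e [ccomp X (smile X x t y) e [\<phi>, \<phi>']] =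
    ccomp X (lmult X (tcod X t)) (x \<cdot> e) [ccomp X (hcell X x t) e [\<phi>], ccomp X (hcell X t y) (cright X \<phi>) [\<phi>']]"
proof -
  have fr: "\<phi> \<in> Cell X" "\<phi>' \<in> Cell X" "ctgt X \<phi> = hom X x t" "ctgt X \<phi>' = hom X t y" "cleft X \<phi> = e"
    "cright X \<phi> = cleft X \<phi>'"
    using assms by (auto simp: comp_ok_simps)
  then have "e \<in> Tight X" "tcod X e = tdom X x" "tcod X (cleft X \<phi>') = tdom X t"
    using assms cell_frameD(2,4)[of \<phi>] cell_frameD(4)[of \<phi>'] by simp_all
  moreover have "ccomp X (ccomp X (hcell X x y) (tid X (tdom X x)) [smile X x t y]) e [\<phi>, \<phi>'] =
    ccomp X (ccomp X (lmult X (tcod X t)) x [hcell X x t, hcell X t y]) e [\<phi>, \<phi>']"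
    using assms by (simp only: hcell_smile)
  ultimately show ?thesis using fr assms(1-5) by (simp add: comp_ok_simps)
qed

lemma frown_props:
  assumes "f \<in> Tight X"
  shows frown_frame [simp]: "frown X f \<in> Cell X" "csrc X (frown X f) = []"
    "ctgt X (frown X f) = hom X f f" "cleft X (frown X f) = tid X (tdom X f)"
    "cright X (frown X f) = tid X (tdom X f)"
    and hcell_frown: "ccomp X (hcell X f f) (tid X (tdom X f)) [frown X f] =
       ccomp X (lunit X (tcod X f)) f []"
proof -
  have "\<exists>!\<beta>. gcell X \<beta> [] (hom X f f) \<and>
       ccomp X (hcell X f f) (tid X (tdom X f)) [\<beta>] = ccomp X (lunit X (tcod X f)) f []"
    using hcell_factor[of f f "tid X (tdom X f)" "tid X (tdom X f)" "ccomp X (lunit X (tcod X f)) f []"] assms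
    by (simp add: comp_ok_simps gcell_def)
  from theI'[OF this] show "frown X f \<in> Cell X" "csrc X (frown X f) = []"
    "ctgt X (frown X f) = hom X f f" "cleft X (frown X f) = tid X (tdom X f)"
    "cright X (frown X f) = tid X (tdom X f)"
    "ccomp X (hcell X f f) (tid X (tdom X f)) [frown X f] =
       ccomp X (lunit X (tcod X f)) f []"
    using assms unfolding frown_def[symmetric] by (auto simp: gcell_iff)
qed

text \<open>The object \<open>A\<close> is a variable with a side condition, because the domain of
  \<open>x\<close> may already have been rewritten when the rule has to match.\<close>

lemma hcell_smile_tid [simp]:
  "\<lbrakk>x \<in> Tight X; t \<in> Tight X; y \<in> Tight X; tcod X x = tcod X t; tcod X y = tcod X t; tdom X x = A\<rbrakk> \<Longrightarrow>
    ccomp X (hcell X x y) (tid X A) [smile X x t y] =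
       ccomp X (lmult X (tcod X t)) x [hcell X x t, hcell X t y]"
  using hcell_smile by auto

lemma hcell_frown_tid [simp]:
  "\<lbrakk>f \<in> Tight X; tdom X f = A\<rbrakk> \<Longrightarrow>
    ccomp X (hcell X f f) (tid X A) [frown X f] = ccomp X (lunit X (tcod X f)) f []"
  using hcell_frown by auto

lemma smile_frown [simp]:
  assumes "x \<in> Tight X" "t \<in> Tight X" "tcod X x = tcod X t" "tdom X x = A"
  shows "ccomp X (smile X x t t) (tid X A) [cid X (hom X x t), frown X t] = cid X (hom X x t)"
proof -
  have "A \<in> Obj X" using assms tdom_Obj by blast+
  then show ?thesis
  using assms by - (rule hcell_mono[of x t], simp_all add: comp_ok_simps)
qed

lemma smile_frown_left [simp]:
  assumes "y \<in> Tight X" "t \<in> Tight X" "tcod X y = tcod X t" "tdom X t = A"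
  shows "ccomp X (smile X t t y) (tid X A) [frown X t, cid X (hom X t y)] = cid X (hom X t y)"
proof -
  have "A \<in> Obj X" using assms tdom_Obj by blast+
  then show ?thesis
  using assms by - (rule hcell_mono[of t y], simp_all add: comp_ok_simps)
qed

lemma smile_assoc:
  assumes "x \<in> Tight X" "s \<in> Tight X" "t \<in> Tight X" "y \<in> Tight X"
    "tcod X x = tcod X t" "tcod X y = tcod X t" "tcod X s = tcod X t" "tdom X x = A" "tdom X s = B"
  shows "ccomp X (smile X x t y) (tid X A) [smile X x s t, cid X (hom X t y)] =
     ccomp X (smile X x s y) (tid X A) [cid X (hom X x s), smile X s t y]"
proof -
  have "A \<in> Obj X" and "B \<in> Obj X" using assms tdom_Obj by blast+
  then show ?thesis
  using assms
  by - (rule hcell_mono[of x y], simp_all add: comp_ok_simps)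
qed

end

section \<open>Functoriality of the action of tight-cells\<close>

context virtual_equipment
begin

lemma hcart_props:
  assumes "f \<in> Tight X" "g \<in> Tight X" "tcod X f = tcod X g" "x \<in> Tight X" "y \<in> Tight X"
    "tcod X x = tdom X f" "tcod X y = tdom X g"
  shows hcart_frame [simp]: "hcart X f g x y \<in> Cell X"
    "csrc X (hcart X f g x y) = [hom X (f \<cdot> x) (g \<cdot> y)]"
    "ctgt X (hcart X f g x y) = hom X f g" "cleft X (hcart X f g x y) = x" "cright X (hcart X f g x y) = y"
    and hcell_hcart [simp]: "ccomp X (hcell X f g) x [hcart X f g x y] = hcell X (f \<cdot> x) (g \<cdot> y)"
proof -
  have "\<exists>!\<kappa>. cell X \<kappa> [hom X (f \<cdot> x) (g \<cdot> y)] (hom X f g) x y \<and>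
       ccomp X (hcell X f g) x [\<kappa>] = hcell X (f \<cdot> x) (g \<cdot> y)"
    using hcell_factor[of f g x y "hcell X (f \<cdot> x) (g \<cdot> y)"] assms by simp
  from theI'[OF this] show "hcart X f g x y \<in> Cell X"
    "csrc X (hcart X f g x y) = [hom X (f \<cdot> x) (g \<cdot> y)]"
    "ctgt X (hcart X f g x y) = hom X f g" "cleft X (hcart X f g x y) = x" "cright X (hcart X f g x y) = y"
    "ccomp X (hcell X f g) x [hcart X f g x y] = hcell X (f \<cdot> x) (g \<cdot> y)"
    unfolding hcart_def[symmetric] by (auto simp: cell_def)
qed

text \<open>The outer tight-cell is a separate variable \<open>d\<close>: when \<open>x\<close> or
  \<open>e\<close> is an identity, the composite \<open>x \<cdot> e\<close> is simplified away
  before the rule could match it.\<close>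

lemma hcell_hcart_ccomp [simp]:
  assumes "f \<in> Tight X" "g \<in> Tight X" "tcod X f = tcod X g" "x \<in> Tight X" "y \<in> Tight X"
    "tcod X x = tdom X f" "tcod X y = tdom X g" "comp_ok X (hcart X f g x y) e [\<phi>]" "d = x \<cdot> e"
  shows "ccomp X (hcell X f g) d [ccomp X (hcart X f g x y) e [\<phi>]] =
    ccomp X (hcell X (f \<cdot> x) (g \<cdot> y)) e [\<phi>]"
proof -
  have "comp_ok X (hcell X f g) x [hcart X f g x y]" using assms by (simp add: comp_ok_simps)
  from ccomp_ccomp_unary[OF this assms(8)] show ?thesis using assms by simp
qed

lemma frown_ext_props:
  assumes "f \<in> Tight X"
  shows frown_ext_frame [simp]: "frown_ext X f \<in> Cell X" "csrc X (frown_ext X f) = [lid X (tdom X f)]"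
    "ctgt X (frown_ext X f) = hom X f f" "cleft X (frown_ext X f) = tid X (tdom X f)"
    "cright X (frown_ext X f) = tid X (tdom X f)"
    and frown_ext_lunit:
      "ccomp X (frown_ext X f) (tid X (tdom X f)) [lunit X (tdom X f)] = frown X f"
proof -
  have "\<exists>!\<beta>. gcell X \<beta> [lid X (tdom X f)] (hom X f f) \<and> \<beta> \<bullet> [lunit X (tdom X f)] = frown X f"
  proof -
    have "(gcell X \<beta> [lid X (tdom X f)] (hom X f f) \<and> \<beta> \<bullet> [lunit X (tdom X f)] = frown X f) \<longleftrightarrow>
      cell X \<beta> ([] @ [lid X (tdom X f)] @ []) (ctgt X (frown X f)) (cleft X (frown X f))
        (cright X (frown X f)) \<and>
      ccomp X \<beta> (tid X (tdom X (cleft X (frown X f))))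
        (map (cid X) [] @ [lunit X (tdom X f)] @ map (cid X) []) = frown X f" for \<beta>
      using assms by (auto simp: cell_def gcell_def gcomp_def)
    then show ?thesis
      using lunit_factor[of "tdom X f" "frown X f" "[]" "[]"] assms by simp
  qed
  from theI'[OF this] show "frown_ext X f \<in> Cell X" "csrc X (frown_ext X f) = [lid X (tdom X f)]"
    "ctgt X (frown_ext X f) = hom X f f" "cleft X (frown_ext X f) = tid X (tdom X f)"
    "cright X (frown_ext X f) = tid X (tdom X f)"
    "ccomp X (frown_ext X f) (tid X (tdom X f)) [lunit X (tdom X f)] = frown X f"
    using assms unfolding frown_ext_def[symmetric] by (auto simp: gcell_iff gcomp_def)
qed

text \<open>The 2-cell \<open>A(1,1) \<Rightarrow> B(1,1)\<close> over \<open>f : A \<rightarrow> B\<close>, through which \<open>\<frown>\<^sub>f(x,y)\<close> is determined.\<close>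

definition lid_map :: "'t \<Rightarrow> 'c" where
  "lid_map f = ccomp X (hcell X f f) (tid X (tdom X f)) [frown_ext X f]"

lemma lid_map_frame [simp]:
  assumes "f \<in> Tight X"
  shows "lid_map f \<in> Cell X" "csrc X (lid_map f) = [lid X (tdom X f)]" "ctgt X (lid_map f) = lid X (tcod X f)"
    "cleft X (lid_map f) = f" "cright X (lid_map f) = f"
  using assms by (simp_all add: lid_map_def comp_ok_simps)

lemma lid_map_lunit [simp]:
  assumes "f \<in> Tight X" "tdom X f = A"
  shows "ccomp X (lid_map f) (tid X A) [lunit X A] = ccomp X (lunit X (tcod X f)) f []"
  using assms frown_ext_lunit[OF assms(1)] tdom_Obj[OF assms(1)] by (simp add: lid_map_def comp_ok_simps)

lemma lid_map_lunit_ccomp: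
  assumes "f \<in> Tight X" "e \<in> Tight X" "tcod X e = tdom X f" "tdom X f = A"
  shows "ccomp X (lid_map f) e [ccomp X (lunit X A) e []] = ccomp X (lunit X (tcod X f)) (f \<cdot> e) []"
proof -
  have "A \<in> Obj X" using assms tdom_Obj by blast
  moreover from this have "ccomp X (ccomp X (lid_map f) (tid X A) [lunit X A]) e [] =
      ccomp X (lid_map f) e [ccomp X (lunit X A) e []]"
    using assms by (subst ccomp_ccomp_unary) (simp_all add: comp_ok_simps)
  ultimately show ?thesis using assms by (simp add: comp_ok_simps)
qed

lemma lid_map_tid [simp]:
  assumes "A \<in> Obj X"
  shows "lid_map (tid X A) = cid X (lid X A)"
  using assms
  by - (rule lunit_cancel[where ps="[]" and rs="[]" and A=A and B=A], simp_all add: comp_ok_simps)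

text \<open>The source of functoriality of \<open>act\<close>. Both sides, precomposed with the unit
  of the domain of \<open>f\<close>, give the unit of the codomain of \<open>g\<close> precomposed
  with \<open>g \<cdot> f\<close>.\<close>

lemma lid_map_tcomp [simp]:
  assumes "f \<in> Tight X" "g \<in> Tight X" "tcod X f = tdom X g"
  shows "lid_map (g \<cdot> f) = ccomp X (lid_map g) f [lid_map f]"
  using assms
  by - (rule lunit_cancel[where ps="[]" and rs="[]" and A="tdom X f" and B="tdom X f"],
      simp_all add: comp_ok_simps lid_map_lunit_ccomp)

lemma act_props:
  assumes "f \<in> Tight X" "x \<in> Tight X" "y \<in> Tight X" "tcod X x = tdom X f" "tcod X y = tdom X f"
  shows act_frame [simp]: "act X f x y \<in> Cell X" "csrc X (act X f x y) = [hom X x y]"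
    "ctgt X (act X f x y) = hom X (f \<cdot> x) (f \<cdot> y)" "cleft X (act X f x y) = tid X (tdom X x)"
    "cright X (act X f x y) = tid X (tdom X y)"
    and hcell_act: "ccomp X (hcell X (f \<cdot> x) (f \<cdot> y)) (tid X (tdom X x)) [act X f x y] =
      ccomp X (lid_map f) x [hcell X x y]"
proof -
  \<comment> \<open>Composing with \<open>hcell X f f\<close> loses nothing and absorbs
    \<open>hcart\<close> into one cartesian cell. The description by \<open>frown_ext\<close> thus
    becomes one to which \<open>hcell_factor\<close> applies directly.\<close>
  have eq: "ccomp X (hcart X f f x y) (tid X (tdom X x)) [\<beta>] = ccomp X (frown_ext X f) x [hcell X x y] \<longleftrightarrow>
    ccomp X (hcell X (f \<cdot> x) (f \<cdot> y)) (tid X (tdom X x)) [\<beta>] = ccomp X (lid_map f) x [hcell X x y]"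
    if "gcell X \<beta> [hom X x y] (hom X (f \<cdot> x) (f \<cdot> y))" for \<beta>
  proof
    assume *: "ccomp X (hcart X f f x y) (tid X (tdom X x)) [\<beta>] = ccomp X (frown_ext X f) x [hcell X x y]"
    have "ccomp X (hcell X f f) x [ccomp X (hcart X f f x y) (tid X (tdom X x)) [\<beta>]] =
      ccomp X (hcell X f f) x [ccomp X (frown_ext X f) x [hcell X x y]]"
      unfolding * ..
    then show "ccomp X (hcell X (f \<cdot> x) (f \<cdot> y)) (tid X (tdom X x)) [\<beta>] = ccomp X (lid_map f) x [hcell X x y]"
      using assms that by (simp add: comp_ok_simps lid_map_def gcell_iff)
  next
    assume "ccomp X (hcell X (f \<cdot> x) (f \<cdot> y)) (tid X (tdom X x)) [\<beta>] = ccomp X (lid_map f) x [hcell X x y]"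
    then show "ccomp X (hcart X f f x y) (tid X (tdom X x)) [\<beta>] = ccomp X (frown_ext X f) x [hcell X x y]"
      using assms that
      by - (rule hcell_mono[of f f], simp_all add: comp_ok_simps gcell_iff lid_map_def)
  qed
  have "\<exists>!\<beta>. gcell X \<beta> [hom X x y] (hom X (f \<cdot> x) (f \<cdot> y)) \<and>
       ccomp X (hcell X (f \<cdot> x) (f \<cdot> y)) (tid X (tdom X x)) [\<beta>] = ccomp X (lid_map f) x [hcell X x y]"
    using hcell_factor[of "f \<cdot> x" "f \<cdot> y" "tid X (tdom X x)" "tid X (tdom X y)"
      "ccomp X (lid_map f) x [hcell X x y]"] assms by (simp add: comp_ok_simps gcell_def)
  then have "\<exists>!\<beta>. gcell X \<beta> [hom X x y] (hom X (f \<cdot> x) (f \<cdot> y)) \<and>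
       ccomp X (hcart X f f x y) (tid X (tdom X x)) [\<beta>] = ccomp X (frown_ext X f) x [hcell X x y]"
    using eq by (simp cong: conj_cong)
  from theI'[OF this] have *: "gcell X (act X f x y) [hom X x y] (hom X (f \<cdot> x) (f \<cdot> y))"
    "ccomp X (hcart X f f x y) (tid X (tdom X x)) [act X f x y] = ccomp X (frown_ext X f) x [hcell X x y]"
    unfolding act_def[symmetric] by auto
  show "act X f x y \<in> Cell X" "csrc X (act X f x y) = [hom X x y]"
    "ctgt X (act X f x y) = hom X (f \<cdot> x) (f \<cdot> y)" "cleft X (act X f x y) = tid X (tdom X x)"
    "cright X (act X f x y) = tid X (tdom X y)"
    "ccomp X (hcell X (f \<cdot> x) (f \<cdot> y)) (tid X (tdom X x)) [act X f x y] =
      ccomp X (lid_map f) x [hcell X x y]"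
    using eq[OF *(1)] * assms by (simp_all add: gcell_iff)
qed

lemma hcell_act_tid [simp]:
  assumes "f \<in> Tight X" "x \<in> Tight X" "y \<in> Tight X" "tcod X x = tdom X f" "tcod X y = tdom X f"
    "tdom X x = A"
  shows "ccomp X (hcell X (f \<cdot> x) (f \<cdot> y)) (tid X A) [act X f x y] = ccomp X (lid_map f) x [hcell X x y]"
  using hcell_act assms by auto

lemma hcell_act_ccomp [simp]:
  assumes "f \<in> Tight X" "x \<in> Tight X" "y \<in> Tight X" "tcod X x = tdom X f" "tcod X y = tdom X f"
    "comp_ok X (act X f x y) e [\<phi>]"
  shows "ccomp X (hcell X (f \<cdot> x) (f \<cdot> y)) e [ccomp X (act X f x y) e [\<phi>]] =
    ccomp X (lid_map f) (x \<cdot> e) [ccomp X (hcell X x y) e [\<phi>]]"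
proof -
  have "comp_ok X (hcell X (f \<cdot> x) (f \<cdot> y)) (tid X (tdom X x)) [act X f x y]" "comp_ok X (lid_map f) x [hcell X x y]"
    using assms(1-5) by (simp_all add: comp_ok_simps)
  moreover have \<phi>: "\<phi> \<in> Cell X" "ctgt X \<phi> = hom X x y" "cleft X \<phi> = e"
    using assms by (auto simp: comp_ok_simps)
  moreover from \<phi> have "e \<in> Tight X" "tcod X e = tdom X x"
    using assms cell_frameD(2,4)[of \<phi>] by simp_all
  moreover have "comp_ok X (hcell X x y) e [\<phi>]" using \<phi> assms(1-5) by (simp add: comp_ok_simps)
  ultimately show ?thesis
    using ccomp_ccomp_unary[of "hcell X (f \<cdot> x) (f \<cdot> y)" "tid X (tdom X x)" "act X f x y" e "[\<phi>]"]
      ccomp_ccomp_unary[of "lid_map f" x "hcell X x y" e "[\<phi>]"] assms by simp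
qed

lemma act_tid [simp]:
  assumes "x \<in> Tight X" "y \<in> Tight X" "tcod X x = A" "tcod X y = A"
  shows "act X (tid X A) x y = cid X (hom X x y)"
proof -
  have "A \<in> Obj X" using assms tcod_Obj by blast
  then show ?thesis
    using assms hcell_act[of "tid X A" x y] by - (rule hcell_mono[of x y], simp_all add: comp_ok_simps)
qed

text \<open>Under the cartesian cell both sides are \<open>hcell X x y\<close> followed by
  \<open>lid_map\<close>, so \<open>lid_map_tcomp\<close> decides the claim.\<close>

lemma act_tcomp:
  assumes "f \<in> Tight X" "g \<in> Tight X" "x \<in> Tight X" "y \<in> Tight X"
    "tcod X x = tdom X f" "tcod X y = tdom X f" "tcod X f = tdom X g"
  shows "act X (g \<cdot> f) x y = ccomp X (act X g (f \<cdot> x) (f \<cdot> y)) (tid X (tdom X x)) [act X f x y]"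
  using assms hcell_act[of "g \<cdot> f" x y]
  by - (rule hcell_mono[of "g \<cdot> f \<cdot> x" "g \<cdot> f \<cdot> y"], simp_all add: comp_ok_simps)

end

section \<open>Transfer along loose-monad morphisms\<close>

context virtual_double_category
begin

text \<open>A grading chain has unknown length, so its part of a layer cannot be evaluated by
  rewriting; identities over identities are removed by induction instead.\<close>

lemma layer_cids:
  assumes "chain X A ps B"
  shows "layer X (tid X A) (map (cid X) ps @ \<phi>s) (map (cid X) ps @ \<chi>s) =
      map (cid X) ps @ layer X (tid X B) \<phi>s \<chi>s"
    and "layer_ok X (tid X A) (map (cid X) ps @ \<phi>s) (map (cid X) ps @ \<chi>s) \<longleftrightarrow>
      layer_ok X (tid X B) \<phi>s \<chi>s"
  using assms by (induction ps arbitrary: A) (auto simp: comp_ok_simps)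

lemma comp_ok_cids:
  assumes "chain X A ps B" "\<psi> \<in> Cell X" "csrc X \<psi> = ps @ [q]" "cleft X \<psi> = tid X A"
    "\<phi> \<in> Cell X" "ctgt X \<phi> = q" "cleft X \<phi> = tid X B"
  shows "comp_ok X \<psi> (tid X A) (map (cid X) ps @ [\<phi>])"
proof -
  have j: "juxtaposable X (tid X A) (map (cid X) ps @ [\<phi>]) (cright X \<phi>)"
    using juxtaposable_cids[OF assms(1)] assms
    by (intro juxtaposable_append[of X "tid X A" _ "tid X B"]) auto
  have "A \<in> Obj X" using assms(1) chain_Obj by blast
  then show ?thesis
    using j juxtaposable_jux_right[OF j] assms map_ctgt_cids[OF assms(1)]
    by (simp add: comp_ok_def composable_def)
qed

end

context virtual_equipment
begin

lemma smile_assoc_ccomp [simp]: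
  assumes "x \<in> Tight X" "s \<in> Tight X" "t \<in> Tight X" "y \<in> Tight X"
    "tcod X x = tcod X t" "tcod X y = tcod X t" "tcod X s = tcod X t"
    "\<phi> \<in> Cell X" "\<phi>' \<in> Cell X" "\<phi>'' \<in> Cell X"
    "ctgt X \<phi> = hom X x s" "ctgt X \<phi>' = hom X s t" "ctgt X \<phi>'' = hom X t y"
    "cleft X \<phi> = e" "cright X \<phi> = cleft X \<phi>'" "cright X \<phi>' = cleft X \<phi>''"
  shows "ccomp X (smile X x t y) e [ccomp X (smile X x s t) e [\<phi>, \<phi>'], \<phi>''] =
    ccomp X (smile X x s y) e [\<phi>, ccomp X (smile X s t y) (cleft X \<phi>') [\<phi>', \<phi>'']]"
proof -
  have fr: "tcod X (cleft X \<phi>) = tdom X x" "tcod X (cleft X \<phi>') = tdom X s"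
      "tcod X (cleft X \<phi>'') = tdom X t" "tcod X (cright X \<phi>'') = tdom X y"
    using assms cell_frameD(4)[of \<phi>] cell_frameD(4)[of \<phi>'] cell_frameD(4)[of \<phi>'']
      cell_frameD(5)[of \<phi>''] by simp_all
  have tl: "e \<in> Tight X" "tcod X e = tdom X x" "cleft X \<phi>' \<in> Tight X" "cleft X \<phi>'' \<in> Tight X"
    "cright X \<phi>'' \<in> Tight X"
    using assms fr cell_frameD(2)[of \<phi>] by auto
  show ?thesis
    using assms fr tl by - (rule hcell_mono[of x y], simp_all add: comp_ok_simps)
qed

text \<open>Since E(j,\<eta>) is composition with \<eta>, this is the left unit law of
  \<open>smile\<close>. Consequently the unit of the loose-monad E(j,T) is the cell that represents
  \<eta>.\<close>

lemma relmonad_unit: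
  assumes "j \<in> Tight X" "tight X t (tdom X j) (tcod X j)" "gcell X \<eta> [] (hom X j t)"
  shows "hom_post X j j t \<eta> \<bullet> [frown X j] = \<eta>"
proof -
  let ?A = "tdom X j"
  have "ccomp X (ccomp X (smile X j j t) (tid X ?A) [frown X j, cid X (hom X j t)]) (tid X ?A) [\<eta>] =
      ccomp X (smile X j j t) (tid X ?A) [frown X j, \<eta>]"
    using assms by (subst ccomp_ccomp_cons) (simp_all add: comp_ok_simps gcell_iff tight_def)
  then show ?thesis
    using assms by (simp add: comp_ok_simps gcell_iff tight_def hom_post_def gcomp_def)
qed

text \<open>The three laws of a relative monad give in turn the left unit law, the right unit law
  (with \<open>smile_frown\<close>) and associativity (with associativity of
  \<open>smile\<close>).\<close>

lemma relmonad_loose_monad: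
  assumes "relative_monad X j T"
  shows "loose_monad X (tdom X j) (relmonad_lmonad X j T)"
proof -
  define t d \<eta> where tde: "t = carrier T" "d = extension T" "\<eta> = monad_unit T"
  note [simp] = tde[symmetric]
  have j: "j \<in> Tight X" and t: "tight X t (tdom X j) (tcod X j)"
    and d: "gcell X d [hom X j t] (hom X t t)" and \<eta>: "gcell X \<eta> [] (hom X j t)"
    and 1: "hom_pre X j t \<eta> t \<bullet> [d] = cid X (hom X j t)"
    and 2: "d \<bullet> [hom_post X j j t \<eta> \<bullet> [frown X j]] = frown X t"
    and 3: "smile X t t t \<bullet> [d, d] = d \<bullet> [smile X j t t \<bullet> [cid X (hom X j t), d]]"
    using assms by (auto simp: relative_monad_def Let_def)
  note u = relmonad_unit[OF j t \<eta>]
  note ty = j t[unfolded tight_def] d[unfolded gcell_iff] \<eta>[unfolded gcell_iff]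
  have 1: "ccomp X (smile X j t t) (tid X (tdom X j)) [\<eta>, d] = cid X (hom X j t)"
    using 1 ty by (simp add: hom_pre_def gcomp_def comp_ok_simps)
  have 2: "ccomp X d (tid X (tdom X j)) [\<eta>] = frown X t"
    using 2 ty unfolding u by (simp add: gcomp_def)
  have 3: "ccomp X (smile X t t t) (tid X (tdom X j)) [d, d] =
      ccomp X d (tid X (tdom X j)) [ccomp X (smile X j t t) (tid X (tdom X j)) [cid X (hom X j t), d]]"
    using 3 ty by (simp add: gcomp_def comp_ok_simps)
  have "relmonad_lmonad X j T =
      \<lparr> lcarrier = hom X j t, lmonad_mult = smile X j t t \<bullet> [cid X (hom X j t), d], lmonad_unit = \<eta> \<rparr>"
    using u by (simp add: relmonad_lmonad_def Let_def)
  then show ?thesis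
    using ty 1 2 3 by (simp add: loose_monad_def Let_def gcell_iff gcomp_def comp_ok_simps)
qed

section \<open>Transport of opalgebras and graded morphisms\<close>

lemma opalgebra_iff:
  "opalgebra X j T a lt \<longleftrightarrow>
     tight X a (tdom X j) (tcod X a) \<and> gcell X lt [lcarrier (relmonad_lmonad X j T)] (hom X a a) \<and>
     lt \<bullet> [lmonad_unit (relmonad_lmonad X j T)] = frown X a \<and>
     smile X a a a \<bullet> [lt, lt] = lt \<bullet> [lmonad_mult (relmonad_lmonad X j T)]"
  by (simp add: opalgebra_def relmonad_lmonad_def Let_def)

lemma gcell_unary_frame:
  assumes "gcell X \<psi> [p] q"
  shows "p \<in> Loose X" "q \<in> Loose X" "lcod X p = lcod X q" "ldom X p = ldom X q"
proof -
  show q: "q \<in> Loose X" using cell_frameD(1)[of \<psi>] assms by (auto simp: gcell_iff)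
  show "p \<in> Loose X" "lcod X p = lcod X q" "ldom X p = ldom X q"
    using cell_frameD(6)[of \<psi>] assms q by (simp_all add: gcell_iff)
qed

lemma gcomp_unary_assoc:
  assumes "gcell X \<chi> [q] r" "gcell X \<psi> [p] q" "gcell X \<phi> ps p"
  shows "\<chi> \<bullet> [\<psi>] \<bullet> [\<phi>] = \<chi> \<bullet> [\<psi> \<bullet> [\<phi>]]"
proof -
  show ?thesis
    using assms gcell_unary_frame[OF assms(1)] gcell_unary_frame[OF assms(2)]
    by (simp add: gcell_iff gcomp_def comp_ok_simps)
qed

lemma gcell_gcomp_unary:
  assumes "gcell X \<psi> [p] q" "gcell X \<phi> ps p"
  shows "gcell X (\<psi> \<bullet> [\<phi>]) ps q"
proof -
  show ?thesis
    using assms gcell_unary_frame[OF assms(1)] by (simp add: gcell_iff gcomp_def comp_ok_simps)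
qed

lemma gcomp_cid_right: "gcell X \<psi> [p] q \<Longrightarrow> \<psi> \<bullet> [cid X p] = \<psi>"
  using cell_frameD(1)[of \<psi>] by (simp add: gcell_iff gcomp_def)

text \<open>An opalgebra structure on \<open>a\<close> is a 2-cell from the loose-monad to B(a,a)
  that preserves multiplication and unit. Precomposition with a loose-monad morphism keeps this
  property, which makes the transport contravariant.\<close>

lemma opalgebra_transfer:
  assumes "loose_monad_morphism X (tdom X j) (relmonad_lmonad X j T) (relmonad_lmonad X j' T') \<phi>"
    "tdom X j' = tdom X j" "opalgebra X j' T' a lt"
  shows "opalgebra X j T a (lt \<bullet> [\<phi>])"
proof -
  define s \<mu> u where S: "s = lcarrier (relmonad_lmonad X j T)"
    "\<mu> = lmonad_mult (relmonad_lmonad X j T)" "u = lmonad_unit (relmonad_lmonad X j T)"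
  define s' \<mu>' u' where S': "s' = lcarrier (relmonad_lmonad X j' T')"
    "\<mu>' = lmonad_mult (relmonad_lmonad X j' T')" "u' = lmonad_unit (relmonad_lmonad X j' T')"
  note [simp] = S[symmetric] S'[symmetric]
  let ?A = "tdom X j"
  have s: "s \<in> Loose X" "ldom X s = ?A" "lcod X s = ?A" "s' \<in> Loose X" "ldom X s' = ?A" "lcod X s' = ?A"
    and \<mu>: "gcell X \<mu> [s, s] s" and \<mu>': "gcell X \<mu>' [s', s'] s'" and u: "gcell X u [] s"
    and \<phi>: "gcell X \<phi> [s] s'" and \<phi>\<mu>: "\<phi> \<bullet> [\<mu>] = \<mu>' \<bullet> [\<phi>, \<phi>]" and \<phi>u: "\<phi> \<bullet> [u] = u'"
    using assms(1) by (auto simp: loose_monad_morphism_def loose_monad_def Let_def)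
  have A: "?A \<in> Obj X" using s(1,2) ldom_Obj by metis
  have a: "tight X a ?A (tcod X a)" and lt: "gcell X lt [s'] (hom X a a)" and ltu: "lt \<bullet> [u'] = frown X a"
    and lt\<mu>: "smile X a a a \<bullet> [lt, lt] = lt \<bullet> [\<mu>']"
    using assms(2,3) by (auto simp: opalgebra_iff)
  note ty = A s a[unfolded tight_def] \<mu>[unfolded gcell_iff] \<mu>'[unfolded gcell_iff] u[unfolded gcell_iff]
    \<phi>[unfolded gcell_iff] lt[unfolded gcell_iff]
  have "smile X a a a \<bullet> [lt \<bullet> [\<phi>], lt \<bullet> [\<phi>]] = smile X a a a \<bullet> [lt, lt] \<bullet> [\<phi>, \<phi>]"
    using ty by (simp add: gcomp_def comp_ok_simps)
  also have "\<dots> = lt \<bullet> [\<mu>' \<bullet> [\<phi>, \<phi>]]"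
    unfolding lt\<mu> using ty by (simp add: gcomp_def comp_ok_simps)
  also have "\<dots> = lt \<bullet> [\<phi>] \<bullet> [\<mu>]"
    unfolding \<phi>\<mu>[symmetric] using gcomp_unary_assoc[OF lt \<phi> \<mu>] by simp
  finally have "smile X a a a \<bullet> [lt \<bullet> [\<phi>], lt \<bullet> [\<phi>]] = lt \<bullet> [\<phi>] \<bullet> [\<mu>]" .
  moreover have "lt \<bullet> [\<phi>] \<bullet> [u] = frown X a"
    using gcomp_unary_assoc[OF lt \<phi> u] \<phi>u ltu by simp
  ultimately show ?thesis
    using a gcell_gcomp_unary[OF lt \<phi>] by (simp add: opalgebra_iff)
qed

lemma opalgebra_action_gcomp:
  assumes "a \<in> Tight X" "gcell X lt [s'] (hom X a a)" "gcell X \<phi> [s] s'"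
  shows "opalgebra_action X a (lt \<bullet> [\<phi>]) =
    opalgebra_action X a lt \<bullet> [cid X (hom X (tid X (tcod X a)) a), \<phi>]"
proof -
  have "lcod X s' = tdom X a" "ldom X s' = tdom X a" "s' \<in> Loose X"
    using gcell_unary_frame[OF assms(2)] assms(1) by simp_all
  then show ?thesis
    using assms by (simp add: gcell_iff gcomp_def comp_ok_simps opalgebra_action_def Let_def)
qed

lemma opalgebra_action_gcell:
  assumes "a \<in> Tight X" "gcell X lt [s] (hom X a a)"
  shows "gcell X (opalgebra_action X a lt) [hom X (tid X (tcod X a)) a, s] (hom X (tid X (tcod X a)) a)"
  using assms by (simp add: gcell_iff gcomp_def comp_ok_simps opalgebra_action_def Let_def)

text \<open>The cell \<open>\<alpha>\<close> stays the same: its new compatibility equation is the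
  old one precomposed with identities on \<open>ps\<close> and B(1,a) and with \<open>\<phi>\<close>
  in the last place.\<close>

lemma graded_morphism_transfer:
  assumes "gcell X \<phi> [hom X j (carrier T)] (hom X j' (carrier T'))"
    "opalgebra X j' T' a lt" "opalgebra X j' T' a' lt'"
    "graded_morphism X j' T' ps a lt a' lt' \<alpha>"
  shows "graded_morphism X j T ps a (lt \<bullet> [\<phi>]) a' (lt' \<bullet> [\<phi>]) \<alpha>"
proof -
  define s s' where S: "s = hom X j (carrier T)" "s' = hom X j' (carrier T')"
  define p p' where P: "p = hom X (tid X (tcod X a)) a" "p' = hom X (tid X (tcod X a')) a'"
  define \<rho> \<rho>' where \<rho>: "\<rho> = opalgebra_action X a lt" "\<rho>' = opalgebra_action X a' lt'"
  have a: "a \<in> Tight X" "a' \<in> Tight X" "tdom X a = tdom X j'" "tdom X a' = tdom X j'"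
    and lt: "gcell X lt [s'] (hom X a a)" "gcell X lt' [s'] (hom X a' a')" and \<phi>: "gcell X \<phi> [s] s'"
    using assms(1-3) by (auto simp: opalgebra_def Let_def tight_def S)
  have \<rho>g: "gcell X \<rho> [p, s'] p" "gcell X \<rho>' [p', s'] p'"
    unfolding \<rho> P using a lt opalgebra_action_gcell by auto
  have \<alpha>: "gcell X \<alpha> (ps @ [p]) p'" and
    \<alpha>\<rho>: "\<alpha> \<bullet> (map (cid X) ps @ [\<rho>]) = \<rho>' \<bullet> [\<alpha>, cid X s']"
    using assms(4) by (auto simp: graded_morphism_def P \<rho> S)
  let ?B = "tcod X a" and ?B' = "tcod X a'" and ?A = "tdom X j'"
  have p: "p \<in> Loose X" "p' \<in> Loose X" "lcod X p = ?B" "ldom X p = ?A" "lcod X p' = ?B'" "ldom X p' = ?A"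
    using a by (auto simp: P)
  have O: "?B \<in> Obj X" "?B' \<in> Obj X" "?A \<in> Obj X" using a tcod_Obj tdom_Obj by metis+
  have s: "lcod X s' = ?A" "ldom X s' = ?A" "s' \<in> Loose X"
    using gcell_unary_frame[OF lt(1)] a by simp_all
  have s2: "lcod X s = ?A" "ldom X s = ?A" "s \<in> Loose X"
    using gcell_unary_frame[OF \<phi>] s by simp_all
  note ty = O s s2 p \<alpha>[unfolded gcell_iff] \<phi>[unfolded gcell_iff] \<rho>g[unfolded gcell_iff]
  have chp: "chain X ?B' (ps @ [p]) ?A"
    using cell_frameD(6)[of \<alpha>] ty by simp
  then have ch: "chain X ?B' ps ?B" using chain_appendD[of ?B' ps "[p]" ?A] p by auto
  have cids: "ccomp X \<alpha> (tid X ?B') (map (cid X) ps @ [cid X p]) = \<alpha>"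
    using ccomp_cids[of \<alpha> "ps @ [p]" ?B'] ty by simp
  have ok1: "comp_ok X \<alpha> (tid X ?B') (map (cid X) ps @ [\<rho>])"
    using ty by (intro comp_ok_cids[OF ch, of _ p]) auto
  have ok2: "comp_ok X \<alpha> (tid X ?B') (map (cid X) ps @ [cid X p])"
    using ty by (intro comp_ok_cids[OF ch, of _ p]) auto
  have "\<alpha> \<bullet> (map (cid X) ps @ [\<rho> \<bullet> [cid X p, \<phi>]]) =
      ccomp X (ccomp X \<alpha> (tid X ?B') (map (cid X) ps @ [\<rho>])) (tid X ?B') (map (cid X) ps @ [cid X p, \<phi>])"
    using ty ok1 by (subst ccomp_ccomp) (simp_all add: layer_cids[OF ch] comp_ok_simps gcomp_def)
  also have "ccomp X \<alpha> (tid X ?B') (map (cid X) ps @ [\<rho>]) = ccomp X \<rho>' (tid X ?B') [\<alpha>, cid X s']"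
    using \<alpha>\<rho> ty by (simp add: gcomp_def)
  \<comment> \<open>The upper layer is cut after \<open>ps @ [p]\<close>: this block of identities
    lies over \<open>\<alpha>\<close>, which absorbs it by \<open>cids\<close>, and
    \<open>\<phi>\<close> lies over the identity of \<open>s'\<close>.\<close>
  also have "ccomp X (ccomp X \<rho>' (tid X ?B') [\<alpha>, cid X s']) (tid X ?B') (map (cid X) ps @ [cid X p, \<phi>]) =
      ccomp X \<rho>' (tid X ?B') [\<alpha>, \<phi>]"
  proof -
    have jr: "jux_right X (tid X ?B') (map (cid X) ps @ [cid X p]) = tid X ?A"
    proof -
      have "juxtaposable X (tid X ?B') (map (cid X) (ps @ [p])) (tid X ?A)"
        using juxtaposable_cids[OF chp] .
      from juxtaposable_jux_right[OF this] show ?thesis by simp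
    qed
    show ?thesis
      using ty cids ok2 by (subst ccomp_ccomp) (simp_all add: comp_ok_simps jr)
  qed
  also have "\<dots> = \<rho>' \<bullet> [cid X p', \<phi>] \<bullet> [\<alpha>, cid X s]"
    using ty by (simp add: gcomp_def comp_ok_simps)
  finally show ?thesis
    using \<alpha> opalgebra_action_gcomp[OF a(1) lt(1) \<phi>] opalgebra_action_gcomp[OF a(2) lt(2) \<phi>]
    by (simp add: graded_morphism_def P \<rho> S)
qed

lemma relmonad_lmonad_trivial:
  assumes "l \<in> Tight X"
  shows "relmonad_lmonad X l (trivial_relmonad X l) = tight_lmonad X l"
proof -
  have "hom_post X l l l (frown X l) \<bullet> [frown X l] = frown X l"
    using assms by (intro relmonad_unit) (simp_all add: tight_def gcell_iff)
  then show ?thesis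
    using assms
    by (simp add: relmonad_lmonad_def trivial_relmonad_def tight_lmonad_def gcomp_def)
qed

lemma tight_loose_monad:
  "l \<in> Tight X \<Longrightarrow> loose_monad X (tdom X l) (tight_lmonad X l)"
  by (simp add: loose_monad_def tight_lmonad_def Let_def gcell_iff gcomp_def smile_assoc)

lemma gcomp_cancel:
  assumes "gcell X \<chi> [q] r" "gcell X \<psi> [p] q" "gcell X \<phi> [q] p" "\<psi> \<bullet> [\<phi>] = cid X q"
  shows "\<chi> \<bullet> [\<psi>] \<bullet> [\<phi>] = \<chi>"
  using gcomp_unary_assoc[OF assms(1-3)] gcomp_cid_right[OF assms(1)] assms(4) by simp

text \<open>As for ordinary monoids, the inverse of an invertible homomorphism is a homomorphism, so
  for a resolution only one direction has to be checked.\<close>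

lemma loose_monad_iso_inverseI:
  assumes \<phi>: "loose_monad_morphism X A S S' \<phi>" and \<phi>': "gcell X \<phi>' [lcarrier S'] (lcarrier S)"
    and inv: "\<phi>' \<bullet> [\<phi>] = cid X (lcarrier S)" "\<phi> \<bullet> [\<phi>'] = cid X (lcarrier S')"
  shows "loose_monad_iso X A S S' \<phi>"
proof -
  define s \<mu> u where S: "s = lcarrier S" "\<mu> = lmonad_mult S" "u = lmonad_unit S"
  define s' \<mu>' u' where S': "s' = lcarrier S'" "\<mu>' = lmonad_mult S'" "u' = lmonad_unit S'"
  note [simp] = S[symmetric] S'[symmetric]
  have s: "s \<in> Loose X" "ldom X s = A" "lcod X s = A" "s' \<in> Loose X" "ldom X s' = A" "lcod X s' = A"
    and \<mu>: "gcell X \<mu> [s, s] s" and \<mu>': "gcell X \<mu>' [s', s'] s'" and u: "gcell X u [] s"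
    and m: "loose_monad X A S" "loose_monad X A S'"
    and f: "gcell X \<phi> [s] s'" and \<phi>\<mu>: "\<phi> \<bullet> [\<mu>] = \<mu>' \<bullet> [\<phi>, \<phi>]" and \<phi>u: "\<phi> \<bullet> [u] = u'"
    using \<phi> by (auto simp: loose_monad_morphism_def loose_monad_def Let_def)
  have g: "gcell X \<phi>' [s'] s" using \<phi>' by simp
  have i: "\<phi>' \<bullet> [\<phi>] = cid X s" "\<phi> \<bullet> [\<phi>'] = cid X s'" using inv by simp_all
  have A: "A \<in> Obj X" using s(1,2) ldom_Obj by metis
  note ty = A s \<mu>[unfolded gcell_iff] \<mu>'[unfolded gcell_iff] u[unfolded gcell_iff] f[unfolded gcell_iff]
    g[unfolded gcell_iff]
  \<comment> \<open>Both inputs of \<open>\<mu>'\<close> are expanded into \<open>\<phi>\<close>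
    after \<open>\<phi>'\<close>, so that multiplicativity of \<open>\<phi>\<close> can be
    used.\<close>
  have "\<phi>' \<bullet> [\<mu>'] = \<phi>' \<bullet> [\<mu>' \<bullet> [\<phi> \<bullet> [\<phi>'], \<phi> \<bullet> [\<phi>']]]"
    unfolding i using ty by (simp add: gcomp_def)
  also have "\<dots> = \<phi>' \<bullet> [\<mu>' \<bullet> [\<phi>, \<phi>] \<bullet> [\<phi>', \<phi>']]"
    using ty by (simp add: gcomp_def comp_ok_simps)
  also have "\<dots> = \<phi>' \<bullet> [\<phi>] \<bullet> [\<mu> \<bullet> [\<phi>', \<phi>']]"
    unfolding \<phi>\<mu>[symmetric] using ty by (simp add: gcomp_def comp_ok_simps)
  also have "\<dots> = \<mu> \<bullet> [\<phi>', \<phi>']"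
    unfolding i using ty by (simp add: gcomp_def comp_ok_simps)
  finally have "\<phi>' \<bullet> [\<mu>'] = \<mu> \<bullet> [\<phi>', \<phi>']" .
  moreover have "\<phi>' \<bullet> [u'] = u"
    using gcomp_unary_assoc[OF g f u] i \<phi>u ty by (simp add: gcomp_def)
  ultimately have "loose_monad_morphism X A S' S \<phi>'"
    using m g by (simp add: loose_monad_morphism_def)
  then show ?thesis using \<phi> inv by (auto simp: loose_monad_iso_def)
qed

section \<open>Factorisations and opalgebra objects\<close>

lemma act_gcell:
  "\<lbrakk>tight X b C D; tight X k A C\<rbrakk> \<Longrightarrow> gcell X (act X b k k) [hom X k k] (hom X (b \<cdot> k) (b \<cdot> k))"
  by (auto simp: tight_def gcell_iff)

lemma opalgebra_factor_gcomp:
  assumes "opalgebra_factor X k ltk b a lt" "k \<in> Tight X" "gcell X ltk [s] (hom X k k)"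
    "gcell X \<phi> [s'] s"
  shows "opalgebra_factor X k (ltk \<bullet> [\<phi>]) b a (lt \<bullet> [\<phi>])"
proof -
  have "gcell X (act X b k k) [hom X k k] (hom X a a)"
    using act_gcell[of b "tcod X k" "tcod X a" k "tdom X k"] assms(1,2)
    by (auto simp: opalgebra_factor_def tight_def)
  from gcomp_unary_assoc[OF this assms(3,4)] show ?thesis
    using assms(1) by (simp add: opalgebra_factor_def)
qed

lemma opalgebra_factor_tid:
  assumes "k \<in> Tight X" "gcell X ltk [s] (hom X k k)"
  shows "opalgebra_factor X k ltk (tid X (tcod X k)) k ltk"
  using assms by (auto simp: opalgebra_factor_def tight_def gcomp_def gcell_iff)

text \<open>The equation for structure cells is functoriality of \<open>act\<close>; together with
  \<open>opalgebra_factor_tid\<close> this makes factorisations compose like morphisms.\<close>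

lemma opalgebra_factor_tcomp:
  assumes "opalgebra_factor X k ltk b a lt" "opalgebra_factor X a lt c a' lt'"
    "k \<in> Tight X" "gcell X ltk [s] (hom X k k)"
  shows "opalgebra_factor X k ltk (c \<cdot> b) a' lt'"
proof -
  have b: "tight X b (tcod X k) (tcod X a)" "b \<cdot> k = a" "act X b k k \<bullet> [ltk] = lt"
    and c: "tight X c (tcod X a) (tcod X a')" "c \<cdot> a = a'" "act X c a a \<bullet> [lt] = lt'"
    using assms(1,2) by (auto simp: opalgebra_factor_def)
  have k: "tight X k (tdom X k) (tcod X k)" using assms(3) by (simp add: tight_def)
  have a: "tight X a (tdom X k) (tcod X a)" using b k tcomp_tight by blast
  have cbk: "c \<cdot> b \<cdot> k = a'" using b c k tcomp_assoc by metis
  have "act X (c \<cdot> b) k k = act X c a a \<bullet> [act X b k k]"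
    using act_tcomp[of b c k k] b(1,2) c(1) k a by (simp add: tight_def gcomp_def)
  then have "act X (c \<cdot> b) k k \<bullet> [ltk] = lt'"
    using gcomp_unary_assoc[OF act_gcell[OF c(1) a] _ assms(4)] act_gcell[OF b(1) k] b c by simp
  then show ?thesis using tcomp_tight[OF b(1) c(1)] cbk by (simp add: opalgebra_factor_def)
qed

lemma opalgebra_objectD:
  assumes "opalgebra_object X j T k lt"
  shows "opalgebra X j T k lt"
    and "opalgebra X j T a la \<Longrightarrow> \<exists>!b. opalgebra_factor X k lt b a la"
    and "\<lbrakk>opalgebra X j T a la; opalgebra X j T a' la'; graded_morphism X j T ps a la a' la' \<alpha>;
        opalgebra_factor X k lt b a la; opalgebra_factor X k lt b' a' la'\<rbrakk> \<Longrightarrow>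
      let one = tid X (tcod X a); one' = tid X (tcod X a') in
        \<exists>!\<beta>. gcell X \<beta> (ps @ [hom X one b]) (hom X one' b') \<and>
          restrict_right X ps one b one' b' \<beta> k = \<alpha>"
proof -
  show "opalgebra X j T k lt" using assms unfolding opalgebra_object_def by (rule conjunct1)
next
  assume "opalgebra X j T a la"
  then show "\<exists>!b. opalgebra_factor X k lt b a la"
    using assms[unfolded opalgebra_object_def, THEN conjunct2, THEN conjunct1] by iprover
next
  assume "opalgebra X j T a la" "opalgebra X j T a' la'" "graded_morphism X j T ps a la a' la' \<alpha>"
    "opalgebra_factor X k lt b a la" "opalgebra_factor X k lt b' a' la'"
  then have "opalgebra X j T a la \<and> opalgebra X j T a' la' \<and> graded_morphism X j T ps a la a' la' \<alpha> \<and>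
    opalgebra_factor X k lt b a la \<and> opalgebra_factor X k lt b' a' la'" by (intro conjI)
  then show "let one = tid X (tcod X a); one' = tid X (tcod X a') in
        \<exists>!\<beta>. gcell X \<beta> (ps @ [hom X one b]) (hom X one' b') \<and>
          restrict_right X ps one b one' b' \<beta> k = \<alpha>"
    using assms[unfolded opalgebra_object_def, THEN conjunct2, THEN conjunct2] by iprover
qed

text \<open>Each object factors through the other. The composite comparison and the identity both
  factor an object through itself, hence agree by uniqueness.\<close>

lemma opalgebra_object_unique:
  assumes "opalgebra_object X j T k lt" "opalgebra_object X j T k' lt'"
  shows "\<exists>h. tight_iso X h (tcod X k') (tcod X k) \<and> h \<cdot> k' = k"
proof -
  have o: "opalgebra X j T k lt" "opalgebra X j T k' lt'"
    using assms opalgebra_objectD(1) by blast+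
  have k: "k \<in> Tight X" "gcell X lt [hom X j (carrier T)] (hom X k k)"
    "k' \<in> Tight X" "gcell X lt' [hom X j (carrier T)] (hom X k' k')"
    using o by (auto simp: opalgebra_def Let_def tight_def)
  obtain h where h: "opalgebra_factor X k' lt' h k lt"
    using opalgebra_objectD(2)[OF assms(2) o(1)] by blast
  obtain h' where h': "opalgebra_factor X k lt h' k' lt'"
    using opalgebra_objectD(2)[OF assms(1) o(2)] by blast
  note opalgebra_objectD(2)[OF assms(1) o(1)] opalgebra_objectD(2)[OF assms(2) o(2)]
  then have "h \<cdot> h' = tid X (tcod X k)" "h' \<cdot> h = tid X (tcod X k')"
    using opalgebra_factor_tcomp[OF h h' k(3,4)] opalgebra_factor_tcomp[OF h' h k(1,2)]
      opalgebra_factor_tid[OF k(1,2)] opalgebra_factor_tid[OF k(3,4)] by blast+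
  then show ?thesis using h h' by (auto simp: tight_iso_def opalgebra_factor_def)
qed

text \<open>The tight-cell \<open>k\<close> is kept. Factorising tight-cells and graded morphisms
  remain literally the same, and the condition on \<open>\<beta>\<close> mentions neither monad, so
  the universal property of \<open>T\<close> can be reused.\<close>

lemma opalgebra_object_transfer:
  assumes \<phi>: "loose_monad_morphism X (tdom X j) (relmonad_lmonad X j T) (relmonad_lmonad X j' T') \<phi>"
    and \<phi>': "loose_monad_morphism X (tdom X j) (relmonad_lmonad X j' T') (relmonad_lmonad X j T) \<phi>'"
    and inv: "\<phi>' \<bullet> [\<phi>] = cid X (lcarrier (relmonad_lmonad X j T))"
      "\<phi> \<bullet> [\<phi>'] = cid X (lcarrier (relmonad_lmonad X j' T'))"
    and dom: "tdom X j' = tdom X j" and obj: "opalgebra_object X j T k ltk"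
  shows "opalgebra_object X j' T' k (ltk \<bullet> [\<phi>'])"
proof -
  define s s' where S: "s = hom X j (carrier T)" "s' = hom X j' (carrier T')"
  have car: "lcarrier (relmonad_lmonad X j T) = s" "lcarrier (relmonad_lmonad X j' T') = s'"
    by (simp_all add: relmonad_lmonad_def Let_def S)
  have f: "gcell X \<phi> [s] s'" "gcell X \<phi>' [s'] s"
    using \<phi> \<phi>' by (simp_all add: loose_monad_morphism_def car)
  have "opalgebra X j T k ltk" using obj by (rule opalgebra_objectD)
  then have k: "k \<in> Tight X" "gcell X ltk [s] (hom X k k)"
    by (simp_all add: opalgebra_def Let_def tight_def S)
  have k': "opalgebra X j' T' k (ltk \<bullet> [\<phi>'])"
    using opalgebra_transfer[OF \<phi>'[folded dom] dom[symmetric]] \<open>opalgebra X j T k ltk\<close> .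
  have tr: "opalgebra X j T a (lt \<bullet> [\<phi>])" if "opalgebra X j' T' a lt" for a lt
    using opalgebra_transfer[OF \<phi> dom that] .
  have lt: "gcell X lt [s'] (hom X a a)" if "opalgebra X j' T' a lt" for a lt
    using that by (simp add: opalgebra_def Let_def S)
  \<comment> \<open>Precomposition with \<open>\<phi>\<close> gives one direction, where
    \<open>\<phi>'\<close> and \<open>\<phi>\<close> cancel on \<open>ltk\<close>; precomposition
    with \<open>\<phi>'\<close> gives the other, where they cancel on \<open>lt\<close>.\<close>
  have fac: "opalgebra_factor X k (ltk \<bullet> [\<phi>']) b a lt \<longleftrightarrow> opalgebra_factor X k ltk b a (lt \<bullet> [\<phi>])"
    if "opalgebra X j' T' a lt" for b a lt
  proof
    assume "opalgebra_factor X k (ltk \<bullet> [\<phi>']) b a lt"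
    from opalgebra_factor_gcomp[OF this k(1) gcell_gcomp_unary[OF k(2) f(2)] f(1)]
    show "opalgebra_factor X k ltk b a (lt \<bullet> [\<phi>])"
      using gcomp_cancel[OF k(2) f(2,1)] inv(1) car by simp
  next
    assume "opalgebra_factor X k ltk b a (lt \<bullet> [\<phi>])"
    from opalgebra_factor_gcomp[OF this k(1,2) f(2)]
    show "opalgebra_factor X k (ltk \<bullet> [\<phi>']) b a lt"
      using gcomp_cancel[OF lt[OF that] f(1,2)] inv(2) car by simp
  qed
  have gr: "graded_morphism X j T ps a (lt \<bullet> [\<phi>]) a' (lt' \<bullet> [\<phi>]) \<alpha>"
    if "graded_morphism X j' T' ps a lt a' lt' \<alpha>" "opalgebra X j' T' a lt" "opalgebra X j' T' a' lt'"
    for ps a lt a' lt' \<alpha>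
    using graded_morphism_transfer[OF f(1)[unfolded S] that(2,3,1)] .
  show ?thesis
    unfolding opalgebra_object_def
  proof (intro conjI allI impI)
    show "opalgebra X j' T' k (ltk \<bullet> [\<phi>'])" by (rule k')
  next
    fix a lt assume a: "opalgebra X j' T' a lt"
    then show "\<exists>!b. opalgebra_factor X k (ltk \<bullet> [\<phi>']) b a lt"
      using fac[OF a] opalgebra_objectD(2)[OF obj tr[OF a]] by simp
  next
    fix ps a lt a' lt' \<alpha> b b'
    assume *: "opalgebra X j' T' a lt \<and> opalgebra X j' T' a' lt' \<and>
        graded_morphism X j' T' ps a lt a' lt' \<alpha> \<and>
        opalgebra_factor X k (ltk \<bullet> [\<phi>']) b a lt \<and> opalgebra_factor X k (ltk \<bullet> [\<phi>']) b' a' lt'"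
    then have o: "opalgebra X j' T' a lt" "opalgebra X j' T' a' lt'" by blast+
    show "let one = tid X (tcod X a); one' = tid X (tcod X a') in
          \<exists>!\<beta>. gcell X \<beta> (ps @ [hom X one b]) (hom X one' b') \<and>
               restrict_right X ps one b one' b' \<beta> k = \<alpha>"
      by (rule opalgebra_objectD(3)[OF obj tr[OF o(1)] tr[OF o(2)]])
        (use * gr[OF _ o] fac[OF o(1)] fac[OF o(2)] in simp_all)
  qed
qed

text \<open>As \<open>i\<close> leads from E(j,T) to C(\<ell>,\<ell>), precomposition turns
  \<ell>-opalgebras into \<open>T\<close>-opalgebras. Graded morphisms are not altered, so their
  bijection is the identity map between equal sets.\<close>

lemma opalgebra_correspondence:
  assumes l: "tight X l (tdom X j) (tcod X l)"
    and i: "loose_monad_iso X (tdom X j) (relmonad_lmonad X j T) (tight_lmonad X l) i"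
  shows "bij_betw (\<lambda>(a, lt). (a, lt \<bullet> [i]))
          {(a, lt). opalgebra X l (trivial_relmonad X l) a lt} {(a, lt). opalgebra X j T a lt} \<and>
        (\<forall>ps a lt a' lt'.
          opalgebra X l (trivial_relmonad X l) a lt \<and>
          opalgebra X l (trivial_relmonad X l) a' lt' \<longrightarrow>
          bij_betw (\<lambda>\<alpha>. \<alpha>)
            {\<alpha>. graded_morphism X l (trivial_relmonad X l) ps a lt a' lt' \<alpha>}
            {\<alpha>. graded_morphism X j T ps a (lt \<bullet> [i]) a' (lt' \<bullet> [i]) \<alpha>}) \<and>
        ((\<exists>k lt. opalgebra_object X j T k lt) \<longleftrightarrow>
         (\<exists>k lt. opalgebra_object X l (trivial_relmonad X l) k lt)) \<and>
        (\<forall>k lt k' lt'.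
          opalgebra_object X j T k lt \<and> opalgebra_object X l (trivial_relmonad X l) k' lt' \<longrightarrow>
          (\<exists>h. tight_iso X h (tcod X k') (tcod X k) \<and> h \<cdot> k' = k))"
proof -
  let ?L = "trivial_relmonad X l"
  define s s' where S: "s = hom X j (carrier T)" "s' = hom X l (carrier ?L)"
  have dom: "tdom X l = tdom X j" and "l \<in> Tight X" using l by (auto simp: tight_def)
  have tl: "tight_lmonad X l = relmonad_lmonad X l ?L"
    using relmonad_lmonad_trivial \<open>l \<in> Tight X\<close> by simp
  have car: "lcarrier (relmonad_lmonad X j T) = s" "lcarrier (relmonad_lmonad X l ?L) = s'"
    by (simp_all add: relmonad_lmonad_def Let_def S)
  obtain i' where
    m: "loose_monad_morphism X (tdom X j) (relmonad_lmonad X j T) (relmonad_lmonad X l ?L) i"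
       "loose_monad_morphism X (tdom X j) (relmonad_lmonad X l ?L) (relmonad_lmonad X j T) i'"
    and inv: "i' \<bullet> [i] = cid X s" "i \<bullet> [i'] = cid X s'"
    using i unfolding tl loose_monad_iso_def car by auto
  have g: "gcell X i [s] s'" "gcell X i' [s'] s"
    using m by (simp_all add: loose_monad_morphism_def car)
  note to_T = opalgebra_transfer[OF m(1) dom]
  have to_L: "opalgebra X l ?L a (lt \<bullet> [i'])" if "opalgebra X j T a lt" for a lt
    using opalgebra_transfer[OF m(2)[folded dom] dom[symmetric] that] .
  have back_L: "lt \<bullet> [i] \<bullet> [i'] = lt" if "opalgebra X l ?L a lt" for a lt
    using gcomp_cancel[of lt s' "hom X a a", OF _ g inv(2)] that by (simp add: opalgebra_def Let_def S)
  have back_T: "lt \<bullet> [i'] \<bullet> [i] = lt" if "opalgebra X j T a lt" for a lt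
    using gcomp_cancel[of lt s "hom X a a", OF _ g(2,1) inv(1)] that by (simp add: opalgebra_def Let_def S)
  have obj_L: "opalgebra_object X l ?L k (lt \<bullet> [i'])" if "opalgebra_object X j T k lt" for k lt
    using opalgebra_object_transfer[OF m _ _ dom that] inv car by simp
  have obj_T: "opalgebra_object X j T k (lt \<bullet> [i])" if "opalgebra_object X l ?L k lt" for k lt
    using opalgebra_object_transfer[OF m(2)[folded dom] m(1)[folded dom] _ _ dom[symmetric] that] inv car
    by simp
  have "bij_betw (\<lambda>(a, lt). (a, lt \<bullet> [i])) {(a, lt). opalgebra X l ?L a lt} {(a, lt). opalgebra X j T a lt}"
    using to_T to_L back_L back_T
    by (intro bij_betw_byWitness[where f' = "\<lambda>(a, lt). (a, lt \<bullet> [i'])"]) auto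
  moreover have "bij_betw (\<lambda>\<alpha>. \<alpha>) {\<alpha>. graded_morphism X l ?L ps a lt a' lt' \<alpha>}
      {\<alpha>. graded_morphism X j T ps a (lt \<bullet> [i]) a' (lt' \<bullet> [i]) \<alpha>}"
    if "opalgebra X l ?L a lt" "opalgebra X l ?L a' lt'" for ps a lt a' lt'
  proof -
    \<comment> \<open>The converse transports along \<open>i'\<close>; then \<open>back_L\<close>
      restores the original structures.\<close>
    have "graded_morphism X l ?L ps a lt a' lt' \<alpha> \<longleftrightarrow>
        graded_morphism X j T ps a (lt \<bullet> [i]) a' (lt' \<bullet> [i]) \<alpha>" for \<alpha>
      using graded_morphism_transfer[OF g(1)[unfolded S] that, of ps \<alpha>]
        graded_morphism_transfer[OF g(2)[unfolded S] to_T[OF that(1)] to_T[OF that(2)], of ps \<alpha>]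
        back_L that by auto
    then show ?thesis by (simp add: bij_betw_def)
  qed
  \<comment> \<open>The \<ell>-object becomes a second object for \<open>T\<close> on the same
    tight-cell \<open>k'\<close>, and the two objects for \<open>T\<close> are compared.\<close>
  moreover have "\<exists>h. tight_iso X h (tcod X k') (tcod X k) \<and> h \<cdot> k' = k"
    if "opalgebra_object X j T k lt" "opalgebra_object X l ?L k' lt'" for k lt k' lt'
    using opalgebra_object_unique[OF that(1) obj_T[OF that(2)]] .
  ultimately show ?thesis using obj_L obj_T by blast
qed

text \<open>The empty grading is the case of flat(1,l) and sharp(1,l). For graded cells
  \<open>restrict_right\<close> occurs only inside the universal property, where it is carried along
  unopened.\<close>

lemma restrict_right_props:
  assumes fg: "f \<in> Tight X" "g \<in> Tight X" "tcod X f = tcod X g"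
    and fg': "f' \<in> Tight X" "g' \<in> Tight X" "tcod X f' = tcod X g'"
    and "tdom X f' = tdom X f" "tdom X g' = tdom X g" and y: "y \<in> Tight X" "tcod X y = tdom X g"
    and \<phi>: "gcell X \<phi> [hom X f g] (hom X f' g')"
  shows restrict_right_gcell:
      "gcell X (restrict_right X [] f g f' g' \<phi> y) [hom X f (g \<cdot> y)] (hom X f' (g' \<cdot> y))"
    and hcart_restrict_right:
      "ccomp X (hcart X f' g' (tid X (tdom X f)) y) (tid X (tdom X f)) [restrict_right X [] f g f' g' \<phi> y] =
       ccomp X \<phi> (tid X (tdom X f)) [hcart X f g (tid X (tdom X f)) y]"
proof -
  let ?A = "tid X (tdom X f)" and ?h = "hcart X f g (tid X (tdom X f)) y"
  note ty = assms(1-10) \<phi>[unfolded gcell_iff]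
  \<comment> \<open>As for \<open>act\<close>, composing with \<open>hcell X f' g'\<close> trades
    the factorisation through \<open>hcart\<close> for one through a single cartesian cell.\<close>
  have eq: "ccomp X (hcart X f' g' ?A y) ?A [\<chi>] = ccomp X \<phi> ?A [?h] \<longleftrightarrow>
    ccomp X (hcell X f' (g' \<cdot> y)) ?A [\<chi>] = ccomp X (hcell X f' g') ?A [ccomp X \<phi> ?A [?h]]"
    if "gcell X \<chi> [hom X f (g \<cdot> y)] (hom X f' (g' \<cdot> y))" for \<chi>
  proof
    assume *: "ccomp X (hcart X f' g' ?A y) ?A [\<chi>] = ccomp X \<phi> ?A [?h]"
    have "ccomp X (hcell X f' g') ?A [ccomp X (hcart X f' g' ?A y) ?A [\<chi>]] =
        ccomp X (hcell X f' g') ?A [ccomp X \<phi> ?A [?h]]"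
      unfolding * ..
    then show "ccomp X (hcell X f' (g' \<cdot> y)) ?A [\<chi>] = ccomp X (hcell X f' g') ?A [ccomp X \<phi> ?A [?h]]"
      using ty that by (simp add: comp_ok_simps gcell_iff)
  next
    assume "ccomp X (hcell X f' (g' \<cdot> y)) ?A [\<chi>] = ccomp X (hcell X f' g') ?A [ccomp X \<phi> ?A [?h]]"
    then show "ccomp X (hcart X f' g' ?A y) ?A [\<chi>] = ccomp X \<phi> ?A [?h]"
      using ty that by - (rule hcell_mono[of f' g'], simp_all add: comp_ok_simps gcell_iff)
  qed
  have "\<exists>!\<chi>. gcell X \<chi> [hom X f (g \<cdot> y)] (hom X f' (g' \<cdot> y)) \<and>
      ccomp X (hcell X f' (g' \<cdot> y)) ?A [\<chi>] = ccomp X (hcell X f' g') ?A [ccomp X \<phi> ?A [?h]]"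
    using hcell_factor[of f' "g' \<cdot> y" ?A "tid X (tdom X y)"
        "ccomp X (hcell X f' g') ?A [ccomp X \<phi> ?A [?h]]"] ty
    by (simp add: comp_ok_simps gcell_def)
  then have "\<exists>!\<chi>. gcell X \<chi> ([] @ [hom X f (g \<cdot> y)]) (hom X f' (g' \<cdot> y)) \<and>
      ccomp X (hcart X f' g' (tid X (tdom X f')) y) (tid X (tdom X f')) [\<chi>] =
      ccomp X \<phi> (tid X (tdom X f')) (map (cid X) [] @ [?h])"
    using eq ty by (simp cong: conj_cong)
  from theI'[OF this] have *: "gcell X (restrict_right X [] f g f' g' \<phi> y) [hom X f (g \<cdot> y)] (hom X f' (g' \<cdot> y))"
    "ccomp X (hcart X f' g' ?A y) ?A [restrict_right X [] f g f' g' \<phi> y] = ccomp X \<phi> ?A [?h]"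
    unfolding restrict_right_def using ty by simp_all
  then show "gcell X (restrict_right X [] f g f' g' \<phi> y) [hom X f (g \<cdot> y)] (hom X f' (g' \<cdot> y))"
    "ccomp X (hcart X f' g' ?A y) ?A [restrict_right X [] f g f' g' \<phi> y] = ccomp X \<phi> ?A [?h]"
    by auto
qed

end

section \<open>Resolutions\<close>

context virtual_equipment
begin

text \<open>Followed by \<open>hcell X f g\<close>, the cell \<open>hcart\<close> becomes
  \<open>hcell X f (g \<cdot> y)\<close>, which is cancellable by \<open>hcell_mono\<close>.\<close>

lemma hcart_mono:
  assumes "f \<in> Tight X" "g \<in> Tight X" "tcod X f = tcod X g" "y \<in> Tight X" "tcod X y = tdom X g"
    "gcell X \<chi> ps (hom X f (g \<cdot> y))" "gcell X \<chi>' ps (hom X f (g \<cdot> y))" "tdom X f = A"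
    and eq: "ccomp X (hcart X f g (tid X A) y) (tid X A) [\<chi>] =
      ccomp X (hcart X f g (tid X A) y) (tid X A) [\<chi>']"
  shows "\<chi> = \<chi>'"
proof -
  have A: "A \<in> Obj X" using assms(1,8) tdom_Obj by blast
  have "ccomp X (hcell X f g) (tid X A) [ccomp X (hcart X f g (tid X A) y) (tid X A) [\<chi>]] =
      ccomp X (hcell X f g) (tid X A) [ccomp X (hcart X f g (tid X A) y) (tid X A) [\<chi>']]"
    unfolding eq ..
  then have "ccomp X (hcell X f (g \<cdot> y)) (tid X A) [\<chi>] = ccomp X (hcell X f (g \<cdot> y)) (tid X A) [\<chi>']"
    using A assms(1-8) by (simp add: comp_ok_simps gcell_iff)
  then show ?thesis
    using A assms(1-8) by - (rule hcell_mono[of f "g \<cdot> y"], simp_all add: gcell_iff)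
qed

text \<open>Restriction along \<open>y\<close> respects composition: under \<open>hcart\<close> the
  two restricted cells turn into \<open>\<phi>\<close> followed by \<open>\<phi>'\<close>, which is
  an identity.\<close>

lemma restrict_right_inverse:
  assumes fg: "f \<in> Tight X" "g \<in> Tight X" "tcod X f = tcod X g"
    and fg': "f' \<in> Tight X" "g' \<in> Tight X" "tcod X f' = tcod X g'"
    and dom: "tdom X f' = tdom X f" "tdom X g' = tdom X g" and y: "y \<in> Tight X" "tcod X y = tdom X g"
    and \<phi>: "gcell X \<phi> [hom X f g] (hom X f' g')" and \<phi>': "gcell X \<phi>' [hom X f' g'] (hom X f g)"
    and inv: "\<phi>' \<bullet> [\<phi>] = cid X (hom X f g)"
  shows "restrict_right X [] f' g' f g \<phi>' y \<bullet> [restrict_right X [] f g f' g' \<phi> y] =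
    cid X (hom X f (g \<cdot> y))"
proof -
  let ?A = "tid X (tdom X f)"
  define R R' where R: "R = restrict_right X [] f g f' g' \<phi> y" "R' = restrict_right X [] f' g' f g \<phi>' y"
  have y': "tcod X y = tdom X g'" using y dom by simp
  note rr = restrict_right_gcell[OF fg fg' dom y \<phi>, folded R]
    restrict_right_gcell[OF fg' fg dom[symmetric] y(1) y' \<phi>', folded R]
  have h: "ccomp X (hcart X f' g' ?A y) ?A [R] = ccomp X \<phi> ?A [hcart X f g ?A y]"
    using hcart_restrict_right[OF fg fg' dom y \<phi>] by (simp add: R)
  have h': "ccomp X (hcart X f g ?A y) ?A [R'] = ccomp X \<phi>' ?A [hcart X f' g' ?A y]"
    using hcart_restrict_right[OF fg' fg dom[symmetric] y(1) y' \<phi>'] dom by (simp add: R)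
  note ty = fg fg' dom y \<phi>[unfolded gcell_iff] \<phi>'[unfolded gcell_iff] rr[unfolded gcell_iff]
  have "ccomp X (hcart X f g ?A y) ?A [ccomp X R' ?A [R]] =
      ccomp X (ccomp X (hcart X f g ?A y) ?A [R']) ?A [R]"
    using ty by (subst ccomp_ccomp_unary) (simp_all add: comp_ok_simps)
  also have "\<dots> = ccomp X \<phi>' ?A [ccomp X (hcart X f' g' ?A y) ?A [R]]"
    unfolding h' using ty by (subst ccomp_ccomp_unary) (simp_all add: comp_ok_simps)
  also have "\<dots> = ccomp X (ccomp X \<phi>' ?A [\<phi>]) ?A [hcart X f g ?A y]"
    unfolding h using ty by (subst ccomp_ccomp_unary) (simp_all add: comp_ok_simps)
  also have "\<dots> = ccomp X (hcart X f g ?A y) ?A [cid X (hom X f (g \<cdot> y))]"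
    using inv ty by (simp add: gcomp_def)
  finally have "ccomp X (hcart X f g ?A y) ?A [R' \<bullet> [R]] =
      ccomp X (hcart X f g ?A y) ?A [cid X (hom X f (g \<cdot> y))]"
    using ty by (simp add: gcomp_def)
  then show ?thesis
    unfolding R[symmetric] using fg y rr gcell_gcomp_unary[OF rr(2) rr(1)] cid_gcell
    by - (rule hcart_mono[of f g y _ "[hom X f (g \<cdot> y)]" _ "tdom X f"], simp_all)
qed

section \<open>Right unitors and the action of hom loose-cells\<close>

definition right_unitor :: "'l \<Rightarrow> 'c \<Rightarrow> bool" where
  "right_unitor p R \<longleftrightarrow> gcell X R [p, lid X (ldom X p)] p \<and>
     ccomp X R (tid X (lcod X p)) [cid X p, lunit X (ldom X p)] = cid X p"

text \<open>Opcartesianness of \<open>lunit\<close>, applied to the identity of \<open>p\<close>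
  with the loose-identity inserted after \<open>p\<close>.\<close>

lemma right_unitor_exists:
  assumes "p \<in> Loose X"
  shows "\<exists>R. right_unitor p R"
proof -
  have "right_unitor p R \<longleftrightarrow> cell X R ([p] @ [lid X (ldom X p)] @ []) (ctgt X (cid X p))
        (cleft X (cid X p)) (cright X (cid X p)) \<and>
      ccomp X R (tid X (tdom X (cleft X (cid X p))))
        (map (cid X) [p] @ [lunit X (ldom X p)] @ map (cid X) []) = cid X p" for R
    using assms by (simp add: right_unitor_def gcell_def)
  then show ?thesis
    using lunit_factor[of "ldom X p" "cid X p" "[p]" "[]"] assms by auto
qed

text \<open>Any 2-cell \<open>\<phi>\<close> qualifies: with the unit inserted in the last place,
  both sides reduce to \<open>\<phi>\<close>.\<close>

lemma right_unitor_natural: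
  assumes "right_unitor p R" "right_unitor q R'" "gcell X \<phi> [p] q"
  shows "\<phi> \<bullet> [R] = R' \<bullet> [\<phi>, cid X (lid X (ldom X q))]"
proof -
  note f = gcell_unary_frame[OF assms(3)]
  have R: "gcell X R [p, lid X (ldom X q)] p"
    and Ru: "ccomp X R (tid X (lcod X q)) [cid X p, lunit X (ldom X q)] = cid X p"
    and R': "gcell X R' [q, lid X (ldom X q)] q"
    and Ru': "ccomp X R' (tid X (lcod X q)) [cid X q, lunit X (ldom X q)] = cid X q"
    using assms(1,2) f by (simp_all add: right_unitor_def)
  note ty = f R[unfolded gcell_iff] R'[unfolded gcell_iff] assms(3)[unfolded gcell_iff]
  have "ccomp X R' (tid X (lcod X q)) [\<phi>, lunit X (ldom X q)] =
      ccomp X (ccomp X R' (tid X (lcod X q)) [cid X q, lunit X (ldom X q)]) (tid X (lcod X q)) [\<phi>]"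
    using ty by (subst ccomp_ccomp_cons) (simp_all add: comp_ok_simps)
  also have "\<dots> = \<phi>" unfolding Ru' using ty by simp
  finally show ?thesis
    using ty Ru
    by - (rule lunit_cancel[where ps="[p]" and rs="[]" and A="ldom X q" and B="lcod X q"],
      simp_all add: comp_ok_simps gcomp_def)
qed

text \<open>The action \<open>E(f,gx), C(x,y) \<Rightarrow> E(f,gy)\<close> for \<open>g : C \<rightarrow> E\<close>.\<close>

definition hom_action :: "'t \<Rightarrow> 't \<Rightarrow> 't \<Rightarrow> 't \<Rightarrow> 'c" where
  "hom_action f g x y = smile X f (g \<cdot> x) (g \<cdot> y) \<bullet> [cid X (hom X f (g \<cdot> x)), act X g x y]"

text \<open>Identifies the action as the restriction of the right unitor of E(f,g) along
  \<open>x\<close> and \<open>y\<close>. This transfers naturality of the unitor to the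
  action.\<close>

lemma hcart_hom_action:
  assumes "f \<in> Tight X" "g \<in> Tight X" "tcod X f = tcod X g" "x \<in> Tight X" "y \<in> Tight X"
    "tcod X x = tdom X g" "tcod X y = tdom X g" "tdom X f = A" and R: "right_unitor (hom X f g) R"
  shows "ccomp X (hcart X f g (tid X A) y) (tid X A) [hom_action f g x y] =
    ccomp X R (tid X A) [hcart X f g (tid X A) x, hcell X x y]"
proof -
  have A: "A \<in> Obj X" using assms(1,8) tdom_Obj by blast
  have Rg: "gcell X R [hom X f g, lid X (tdom X g)] (hom X f g)"
    and Ru: "ccomp X R (tid X A) [cid X (hom X f g), lunit X (tdom X g)] = cid X (hom X f g)"
    using R assms(1-8) by (simp_all add: right_unitor_def)
  note ty = A assms(1-8) Rg[unfolded gcell_iff]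
  \<comment> \<open>Seen in E(1,1), the unitor multiplies by the image of C(1,1) under
    \<open>g\<close>. On the unit of C(1,1), \<open>lid_map g\<close> gives the unit of E(1,1),
    which the right unit law absorbs.\<close>
  have *: "ccomp X (hcell X f g) (tid X A) [R] = ccomp X (lmult X (tcod X g)) f [hcell X f g, lid_map g]"
    using ty Ru
    by - (rule lunit_cancel[where ps="[hom X f g]" and rs="[]" and A="tdom X g" and B=A],
      simp_all add: comp_ok_simps)
  have "ccomp X (hcell X f g) (tid X A) [ccomp X R (tid X A) [hcart X f g (tid X A) x, hcell X x y]] =
      ccomp X (ccomp X (hcell X f g) (tid X A) [R]) (tid X A) [hcart X f g (tid X A) x, hcell X x y]"
    using ty by (subst ccomp_ccomp_unary) (simp_all add: comp_ok_simps)
  also have "\<dots> = ccomp X (lmult X (tcod X g)) f [hcell X f (g \<cdot> x), ccomp X (lid_map g) x [hcell X x y]]"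
    unfolding * using ty by (simp add: comp_ok_simps)
  finally show ?thesis
    using ty by - (rule hcell_mono[of f g], simp_all add: comp_ok_simps hom_action_def gcomp_def)
qed

lemma hom_action_gcell:
  assumes "f \<in> Tight X" "g \<in> Tight X" "tcod X f = tcod X g" "x \<in> Tight X" "y \<in> Tight X"
    "tcod X x = tdom X g" "tcod X y = tdom X g"
  shows "gcell X (hom_action f g x y) [hom X f (g \<cdot> x), hom X x y] (hom X f (g \<cdot> y))"
  using assms by (simp add: hom_action_def gcomp_def comp_ok_simps gcell_iff)

text \<open>Both sides are compared under \<open>hcart\<close>, where the actions become the unitors
  \<open>U\<close> and \<open>U'\<close>; what remains is
  \<open>right_unitor_natural\<close>.\<close>

lemma hom_action_natural:
  assumes fg: "f \<in> Tight X" "g \<in> Tight X" "tcod X f = tcod X g"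
    and fg': "f' \<in> Tight X" "g' \<in> Tight X" "tcod X f' = tcod X g'"
    and dom: "tdom X f' = tdom X f" "tdom X g' = tdom X g"
    and x: "x \<in> Tight X" "tcod X x = tdom X g" and y: "y \<in> Tight X" "tcod X y = tdom X g"
    and \<phi>: "gcell X \<phi> [hom X f g] (hom X f' g')"
  shows "restrict_right X [] f g f' g' \<phi> y \<bullet> [hom_action f g x y] =
    hom_action f' g' x y \<bullet> [restrict_right X [] f g f' g' \<phi> x, cid X (hom X x y)]"
proof -
  let ?A = "tid X (tdom X f)"
  define \<phi>x \<phi>y where R: "\<phi>x = restrict_right X [] f g f' g' \<phi> x" "\<phi>y = restrict_right X [] f g f' g' \<phi> y"
  define K K' where K: "K = hom_action f g x y" "K' = hom_action f' g' x y"
  have \<phi>x: "gcell X \<phi>x [hom X f (g \<cdot> x)] (hom X f' (g' \<cdot> x))"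
    and hx: "ccomp X (hcart X f' g' ?A x) ?A [\<phi>x] = ccomp X \<phi> ?A [hcart X f g ?A x]"
    unfolding R using restrict_right_props[OF fg fg' dom x \<phi>] by auto
  have \<phi>y: "gcell X \<phi>y [hom X f (g \<cdot> y)] (hom X f' (g' \<cdot> y))"
    and hy: "ccomp X (hcart X f' g' ?A y) ?A [\<phi>y] = ccomp X \<phi> ?A [hcart X f g ?A y]"
    unfolding R using restrict_right_props[OF fg fg' dom y \<phi>] by auto
  obtain U U' where U: "right_unitor (hom X f g) U" "right_unitor (hom X f' g') U'"
    using right_unitor_exists fg fg' by (meson hcell_frame(6))
  have Ug: "gcell X U [hom X f g, lid X (tdom X g)] (hom X f g)"
      "gcell X U' [hom X f' g', lid X (tdom X g)] (hom X f' g')"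
    using U fg fg' dom by (simp_all add: right_unitor_def)
  have Kg: "gcell X K [hom X f (g \<cdot> x), hom X x y] (hom X f (g \<cdot> y))"
    "gcell X K' [hom X f' (g' \<cdot> x), hom X x y] (hom X f' (g' \<cdot> y))"
    unfolding K using fg fg' dom x y by (auto intro!: hom_action_gcell)
  note ty = fg fg' dom x y \<phi>[unfolded gcell_iff] \<phi>x[unfolded gcell_iff] \<phi>y[unfolded gcell_iff]
    Ug[unfolded gcell_iff] Kg[unfolded gcell_iff]
  have k: "ccomp X (hcart X f g ?A y) ?A [K] = ccomp X U ?A [hcart X f g ?A x, hcell X x y]"
    unfolding K using fg dom x y U by (intro hcart_hom_action) simp_all
  have k': "ccomp X (hcart X f' g' ?A y) ?A [K'] = ccomp X U' ?A [hcart X f' g' ?A x, hcell X x y]"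
    unfolding K using fg' dom x y U by (intro hcart_hom_action) simp_all
  have nat: "ccomp X \<phi> ?A [U] = ccomp X U' ?A [\<phi>, cid X (lid X (tdom X g))]"
    using right_unitor_natural[OF U \<phi>] ty by (simp add: gcomp_def)
  have "ccomp X (hcart X f' g' ?A y) ?A [ccomp X \<phi>y ?A [K]] =
      ccomp X (ccomp X (hcart X f' g' ?A y) ?A [\<phi>y]) ?A [K]"
    using ty by (subst ccomp_ccomp_unary) (simp_all add: comp_ok_simps)
  also have "\<dots> = ccomp X \<phi> ?A [ccomp X (hcart X f g ?A y) ?A [K]]"
    unfolding hy using ty by (subst ccomp_ccomp_unary) (simp_all add: comp_ok_simps)
  also have "\<dots> = ccomp X (ccomp X \<phi> ?A [U]) ?A [hcart X f g ?A x, hcell X x y]"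
    unfolding k using ty by (subst ccomp_ccomp_unary) (simp_all add: comp_ok_simps)
  also have "\<dots> = ccomp X U' ?A [ccomp X (hcart X f' g' ?A x) ?A [\<phi>x], hcell X x y]"
    unfolding nat hx using ty by (subst ccomp_ccomp_cons) (simp_all add: comp_ok_simps)
  also have "\<dots> = ccomp X (ccomp X (hcart X f' g' ?A y) ?A [K']) ?A [\<phi>x, cid X (hom X x y)]"
    unfolding k' using ty by (subst ccomp_ccomp_cons) (simp_all add: comp_ok_simps)
  also have "\<dots> = ccomp X (hcart X f' g' ?A y) ?A [ccomp X K' ?A [\<phi>x, cid X (hom X x y)]]"
    using ty by (subst ccomp_ccomp_unary) (simp_all add: comp_ok_simps)
  finally have "ccomp X (hcart X f' g' ?A y) ?A [\<phi>y \<bullet> [K]] =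
      ccomp X (hcart X f' g' ?A y) ?A [K' \<bullet> [\<phi>x, cid X (hom X x y)]]"
    using ty by (simp add: gcomp_def)
  moreover have "gcell X (K' \<bullet> [\<phi>x, cid X (hom X x y)]) [hom X f (g \<cdot> x), hom X x y] (hom X f' (g' \<cdot> y))"
    using ty by (simp add: gcomp_def gcell_iff comp_ok_simps)
  ultimately show ?thesis
    unfolding R[symmetric] K[symmetric] using fg' y dom gcell_gcomp_unary[OF \<phi>y Kg(1)]
    by - (rule hcart_mono[of f' g' y], simp_all)
qed

text \<open>The isomorphism is \<open>F\<close>, that is flat(1,l), with inverse \<open>S\<close>,
  that is sharp(1,l).\<close>

lemma resolution_loose_monad_iso:
  assumes "relative_monad X j T" "resolution X j T l r sharp flat"
  shows "\<exists>i. loose_monad_iso X (tdom X j) (relmonad_lmonad X j T) (tight_lmonad X l) i"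
proof -
  let ?one = "tid X (tcod X l)" and ?A = "tid X (tdom X j)"
  define F S where FS: "F = restrict_right X [] j r l ?one flat l"
    "S = restrict_right X [] l ?one j r sharp l"
  have adj: "j \<in> Tight X \<and> tight X l (tdom X j) (tcod X l) \<and> tight X r (tcod X l) (tcod X j) \<and>
      gcell X sharp [hom X l ?one] (hom X j r) \<and> gcell X flat [hom X j r] (hom X l ?one) \<and>
      flat \<bullet> [sharp] = cid X (hom X l ?one) \<and> sharp \<bullet> [flat] = cid X (hom X j r)"
    using assms(2) unfolding resolution_def relative_adjunction_def Let_def by (rule conjunct1)
  have "T = induced_relmonad X j l r sharp flat"
    using assms(2) unfolding resolution_def by (rule conjunct2[THEN sym])
  then have T: "T = \<lparr> carrier = r \<cdot> l, extension = act X r l l \<bullet> [F], monad_unit = S \<bullet> [frown X l] \<rparr>"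
    unfolding induced_relmonad_def Let_def FS .
  from adj have j: "j \<in> Tight X" and l: "tight X l (tdom X j) (tcod X l)" and r: "tight X r (tcod X l) (tcod X j)"
    and sf: "gcell X sharp [hom X l ?one] (hom X j r)" "gcell X flat [hom X j r] (hom X l ?one)"
      "flat \<bullet> [sharp] = cid X (hom X l ?one)" "sharp \<bullet> [flat] = cid X (hom X j r)"
    by blast+
  have lr: "l \<in> Tight X" "r \<in> Tight X" "tdom X l = tdom X j" "tdom X r = tcod X l" "tcod X r = tcod X j"
    using l r by (auto simp: tight_def)
  \<comment> \<open>The last equation makes the target of \<open>F\<close> the loose-cell
    \<open>hom X l l\<close> itself.\<close>
  have one: "?one \<in> Tight X" "tdom X ?one = tcod X l" "tcod X ?one = tcod X l" "?one \<cdot> l = l"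
    using lr by simp_all
  have jr: "j \<in> Tight X" "r \<in> Tight X" "tcod X j = tcod X r"
    and l1: "l \<in> Tight X" "?one \<in> Tight X" "tcod X l = tcod X ?one"
    and dom: "tdom X l = tdom X j" "tdom X ?one = tdom X r"
    and ll: "l \<in> Tight X" "tcod X l = tdom X r" and ll': "l \<in> Tight X" "tcod X l = tdom X ?one"
    using j lr one by simp_all
  have F: "gcell X F [hom X j (r \<cdot> l)] (hom X l l)"
    unfolding FS using restrict_right_gcell[OF jr l1 dom ll sf(2)] one by simp
  have S: "gcell X S [hom X l l] (hom X j (r \<cdot> l))"
    unfolding FS using restrict_right_gcell[OF l1 jr dom[symmetric] ll' sf(1)] one by simp
  have FS_inv: "F \<bullet> [S] = cid X (hom X l l)"
    unfolding FS using restrict_right_inverse[OF l1 jr dom[symmetric] ll' sf(1,2,3)] one by simp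
  have SF_inv: "S \<bullet> [F] = cid X (hom X j (r \<cdot> l))"
    unfolding FS using restrict_right_inverse[OF jr l1 dom ll sf(2,1,4)] by simp
  \<comment> \<open>On the side of C(l,1) the action is along an identity tight-cell, where
    \<open>act\<close> is trivial and only \<open>smile X l l l\<close> remains.\<close>
  have nat: "F \<bullet> [hom_action j r l l] = smile X l l l \<bullet> [F, cid X (hom X l l)]"
  proof -
    have "hom_action l ?one l l = smile X l l l"
      using j lr one tdom_Obj[of j] by (simp add: hom_action_def gcomp_def)
    then show ?thesis
      unfolding FS using hom_action_natural[OF jr l1 dom ll ll sf(2)] one by simp
  qed
  have fr: "gcell X (frown X l) [] (hom X l l)" using lr by (simp add: gcell_iff)
  have u: "hom_post X j j (r \<cdot> l) (S \<bullet> [frown X l]) \<bullet> [frown X j] = S \<bullet> [frown X l]"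
    using j lr gcell_gcomp_unary[OF S fr] by (intro relmonad_unit) (simp_all add: tight_def)
  define \<mu> where "\<mu> = smile X j (r \<cdot> l) (r \<cdot> l) \<bullet> [cid X (hom X j (r \<cdot> l)), act X r l l \<bullet> [F]]"
  have lm: "relmonad_lmonad X j T =
      \<lparr> lcarrier = hom X j (r \<cdot> l), lmonad_mult = \<mu>, lmonad_unit = S \<bullet> [frown X l] \<rparr>"
    by (simp add: relmonad_lmonad_def T u \<mu>_def Let_def)
  note ty = j lr F[unfolded gcell_iff] S[unfolded gcell_iff]
  \<comment> \<open>The extension operator is \<open>act X r l l\<close> after \<open>F\<close>, so
    \<open>\<mu>\<close> is the action with \<open>F\<close> in its second argument;
    \<open>nat\<close> then puts \<open>F\<close> into the first argument too.\<close>
  have "F \<bullet> [\<mu>] = F \<bullet> [hom_action j r l l] \<bullet> [cid X (hom X j (r \<cdot> l)), F]"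
    using ty by (simp add: \<mu>_def hom_action_def gcomp_def comp_ok_simps)
  also have "\<dots> = smile X l l l \<bullet> [F, F]"
    unfolding nat using ty by (simp add: gcomp_def comp_ok_simps)
  finally have "F \<bullet> [\<mu>] = smile X l l l \<bullet> [F, F]" .
  moreover have "F \<bullet> [S \<bullet> [frown X l]] = frown X l"
    using gcomp_unary_assoc[OF F S fr] FS_inv fr by (simp add: gcomp_def gcell_iff lr)
  ultimately have "loose_monad_morphism X (tdom X j) (relmonad_lmonad X j T) (tight_lmonad X l) F"
    using relmonad_loose_monad[OF assms(1)] tight_loose_monad[of l] lr F
    by (simp add: loose_monad_morphism_def lm tight_lmonad_def)
  then have "loose_monad_iso X (tdom X j) (relmonad_lmonad X j T) (tight_lmonad X l) F"
    using loose_monad_iso_inverseI[of "tdom X j" _ _ F S] S FS_inv SF_inv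
    by (simp add: lm tight_lmonad_def)
  then show ?thesis by blast
qed

end

theorem proposition6p56:
  fixes X :: "('o, 't, 'l, 'c) vdc" (structure)
    and j :: 't and T :: "('t, 'c) relmonad"
  assumes "virtual_equipment X"
    and "relative_monad X j T"
  shows
    "(\<forall>l i. tight X l (tdom X j) (tcod X l) \<and>
        loose_monad_iso X (tdom X j) (relmonad_lmonad X j T) (tight_lmonad X l) i \<longrightarrow>
        bij_betw (\<lambda>(a, lt). (a, lt \<bullet> [i]))
          {(a, lt). opalgebra X l (trivial_relmonad X l) a lt} {(a, lt). opalgebra X j T a lt} \<and>
        (\<forall>ps a lt a' lt'.
          opalgebra X l (trivial_relmonad X l) a lt \<and>
          opalgebra X l (trivial_relmonad X l) a' lt' \<longrightarrow>
          bij_betw (\<lambda>\<alpha>. \<alpha>)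
            {\<alpha>. graded_morphism X l (trivial_relmonad X l) ps a lt a' lt' \<alpha>}
            {\<alpha>. graded_morphism X j T ps a (lt \<bullet> [i]) a' (lt' \<bullet> [i]) \<alpha>}) \<and>
        ((\<exists>k lt. opalgebra_object X j T k lt) \<longleftrightarrow>
         (\<exists>k lt. opalgebra_object X l (trivial_relmonad X l) k lt)) \<and>
        (\<forall>k lt k' lt'.
          opalgebra_object X j T k lt \<and> opalgebra_object X l (trivial_relmonad X l) k' lt' \<longrightarrow>
          (\<exists>h. tight_iso X h (tcod X k') (tcod X k) \<and> h \<cdot> k' = k)))
     \<and>
     (\<forall>l r sharp flat. resolution X j T l r sharp flat \<longrightarrow>
        (\<exists>i. loose_monad_iso X (tdom X j) (relmonad_lmonad X j T) (tight_lmonad X l) i \<and>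
        bij_betw (\<lambda>(a, lt). (a, lt \<bullet> [i]))
          {(a, lt). opalgebra X l (trivial_relmonad X l) a lt} {(a, lt). opalgebra X j T a lt} \<and>
        (\<forall>ps a lt a' lt'.
          opalgebra X l (trivial_relmonad X l) a lt \<and>
          opalgebra X l (trivial_relmonad X l) a' lt' \<longrightarrow>
          bij_betw (\<lambda>\<alpha>. \<alpha>)
            {\<alpha>. graded_morphism X l (trivial_relmonad X l) ps a lt a' lt' \<alpha>}
            {\<alpha>. graded_morphism X j T ps a (lt \<bullet> [i]) a' (lt' \<bullet> [i]) \<alpha>}) \<and>
        ((\<exists>k lt. opalgebra_object X j T k lt) \<longleftrightarrow>
         (\<exists>k lt. opalgebra_object X l (trivial_relmonad X l) k lt)) \<and>
        (\<forall>k lt k' lt'.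
          opalgebra_object X j T k lt \<and> opalgebra_object X l (trivial_relmonad X l) k' lt' \<longrightarrow>
          (\<exists>h. tight_iso X h (tcod X k') (tcod X k) \<and> h \<cdot> k' = k))))"
proof -
  interpret virtual_equipment X by fact
  show ?thesis
  proof ((rule conjI; intro allI impI), goal_cases)
    case (1 l i)
    then show ?case using opalgebra_correspondence[OF conjunct1[OF 1] conjunct2[OF 1]] by iprover
  next
    case (2 l r sharp flat)
    have l: "tight X l (tdom X j) (tcod X l)"
      using 2 unfolding resolution_def relative_adjunction_def by blast
    obtain i where i: "loose_monad_iso X (tdom X j) (relmonad_lmonad X j T) (tight_lmonad X l) i"
      using resolution_loose_monad_iso[OF assms(2) 2] by blast
    show ?case
      by (rule exI[of _ i], rule conjI[OF i opalgebra_correspondence[OF l i]])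
  qed
qed

end
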